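(* Let the setting and standing assumptions in the context hold, and run the retraction-based Riemannian Bregman gradient method (described in the context) with initial point $x_0=\widetilde{x}$ and $\gamma_t=L$ for all $t\ge 0$. Then every limit point $x$ of the generated sequence $\{x_t\}_{t\ge 0}$ satisfies $x\in\mathcal M$ and the optimality condition $0\in\operatorname{grad} f(x)+\mathcal P_{\mathcal T_x\mathcal M}(\partial g(x))$. Moreover, for any given accuracy $\epsilon>0$, after at most $\mathcal O(\epsilon^{-2})$ iterations the method returns a direction with $\|v_t\|\le\epsilon$; that is, there is a constant $C>0$ independent of $\epsilon$ such that for every $\epsilon>0$ there is an index $t\le C\epsilon^{-2}$ with $\|v_t\|\le\epsilon$.
   Context: Setting. $\mathcal M\subseteq\mathbb R^n$ is a $C^\infty$ embedded submanifold, complete, endowed with the Euclidean inner product on each tangent space $\mathcal T_x\mathcal M$ (viewed as a linear subspace of $\mathbb R^n$). The problem is $\min_{x\in\mathcal M}F(x)=f(x)+g(x)$, with $f:\mathbb R^n\to\mathbb R$ continuously differentiable (possibly nonconvex), $g:\mathbb R^n\to\mathbb R$ convex and $L_g$-Lipschitz continuous (possibly nonsmooth), and $\inf_{\mathcal M}F>-\infty$. Assumptions. $h:\mathbb R^n\to\mathbb R$ is continuously differentiable and $\lambda$-strongly convex, $\lambda>0$; its Bregman distance is $D_h(y,x)=h(y)-h(x)-\langle\nabla h(x),y-x\rangle$. The function $f$ is $L$-smooth relative to $h$ ($L>0$): $f(y)\le f(x)+\langle\nabla f(x),y-x\rangle+L\,D_h(y,x)$ for all $x,y\in\mathbb R^n$.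 For some point $\widetilde{x}\in\mathcal M$, the sublevel set $\mathcal L(\widetilde{x})=\{x\in\mathcal M:F(x)\le F(\widetilde{x})\}$ is compact. Notation. $\mathcal P_{\mathcal T_x\mathcal M}$ is the orthogonal projection onto $\mathcal T_x\mathcal M$; $\operatorname{grad} f(x)=\mathcal P_{\mathcal T_x\mathcal M}(\nabla f(x))$; $\partial g$ is the Euclidean convex subdifferential. A retraction is a smooth map $\operatorname{Retr}:\mathcal T\mathcal M\to\mathcal M$, defined on the whole tangent bundle, such that $\operatorname{Retr}(x,0)=x$ and the differential of $\operatorname{Retr}(x,\cdot)$ at $0$ is the identity of $\mathcal T_x\mathcal M$; one such retraction is fixed. Algorithm (retraction-based Riemannian Bregman gradient method). Input $x_0\in\mathcal M$, $\gamma_t\ge L$, $\rho\in(0,1)$. For $t=0,1,\dots$: compute $$v_t=\arg\min_{v\in\mathcal T_{x_t}\mathcal M}\ \langle\nabla f(x_t),v\rangle+\gamma_tD_h(x_t+v,x_t)+g(x_t+v);$$ set $\alpha_t=1$; while $F(\operatorname{Retr}(x_t,\alpha_tv_t))-F(x_t)>-\frac{\gamma_t\lambda\alpha_t}{4}\|v_t\|^2$, replace $\alpha_t$ by $\rho\alpha_t$; then set $x_{t+1}=\operatorname{Retr}(x_t,\alpha_tv_t)$. *)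

theory Defs
  imports "HOL-Analysis.Analysis" "HOL-Library.While_Combinator"
begin

subsection \<open>Smooth maps\<close>

text \<open>\<open>k_smooth_on k S f\<close> says that \<open>f\<close> is \<open>C\<^sup>k\<close> on \<open>S\<close>, and \<open>smooth_on S f\<close> that it is
  \<open>C\<^sup>\<infinity>\<close>. Both are meant for open \<open>S\<close> only: the derivatives are full Frechet derivatives.\<close>

primrec k_smooth_on :: "nat \<Rightarrow> 'a::real_normed_vector set \<Rightarrow> ('a \<Rightarrow> 'b::real_normed_vector) \<Rightarrow> bool"
  where
    "k_smooth_on 0 S f \<longleftrightarrow> continuous_on S f"
  | "k_smooth_on (Suc k) S f \<longleftrightarrow>
       (\<forall>x\<in>S. f differentiable (at x)) \<and>
       (\<forall>v. k_smooth_on k S (\<lambda>x. frechet_derivative f (at x) v))"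

definition smooth_on :: "'a::real_normed_vector set \<Rightarrow> ('a \<Rightarrow> 'b::real_normed_vector) \<Rightarrow> bool"
  where "smooth_on S f \<longleftrightarrow> (\<forall>k. k_smooth_on k S f)"

text \<open>Smoothness on a set that need not be open, by local smooth extension to the ambient space. On an
  embedded submanifold this is smoothness in the sense of manifolds.\<close>

definition smooth_on_subset :: "'a::real_normed_vector set \<Rightarrow> ('a \<Rightarrow> 'b::real_normed_vector) \<Rightarrow> bool"
  where "smooth_on_subset S f \<longleftrightarrow>
    (\<forall>x\<in>S. \<exists>U f'. open U \<and> x \<in> U \<and> smooth_on U f' \<and> (\<forall>y\<in>S \<inter> U. f' y = f y))"

subsection \<open>Embedded submanifolds of Euclidean space\<close>

text \<open>Slice charts; the dimension is the same at all points.\<close>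

definition embedded_submanifold :: "'a::euclidean_space set \<Rightarrow> bool"
  where "embedded_submanifold M \<longleftrightarrow>
    (\<exists>d. \<forall>x\<in>M. \<exists>U (V :: 'a set) E \<phi> \<psi>.
       open U \<and> x \<in> U \<and> open V \<and> subspace E \<and> dim E = d \<and>
       homeomorphism U V \<phi> \<psi> \<and> smooth_on U \<phi> \<and> smooth_on V \<psi> \<and>
       \<phi> ` (M \<inter> U) = E \<inter> V)"

definition tangent_space :: "'a::euclidean_space set \<Rightarrow> 'a \<Rightarrow> 'a set"
  where "tangent_space M x =
    {v. \<exists>c e. e > 0 \<and> smooth_on {-e<..<e} c \<and> c ` {-e<..<e} \<subseteq> M \<and> c (0::real) = x \<and>
          (c has_vector_derivative v) (at 0)}"

definition tangent_bundle :: "'a::euclidean_space set \<Rightarrow> ('a \<times> 'a) set"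
  where "tangent_bundle M = (SIGMA x:M. tangent_space M x)"

text \<open>Infimum of the lengths of piecewise continuously differentiable curves inside \<open>M\<close>; it is \<open>\<infinity>\<close>
  for points in different components.\<close>

definition riemannian_dist :: "'a::euclidean_space set \<Rightarrow> 'a \<Rightarrow> 'a \<Rightarrow> ennreal"
  where "riemannian_dist M x y =
    (INF c\<in>{c. valid_path c \<and> path_image c \<subseteq> M \<and> pathstart c = x \<and> pathfinish c = y}.
       ennreal (integral {0..1} (\<lambda>t. norm (vector_derivative c (at t)))))"

text \<open>Completeness for the intrinsic distance. For the Euclidean distance it would say that \<open>M\<close> is
  closed, which is a stronger condition.\<close>

definition riemannian_complete :: "'a::euclidean_space set \<Rightarrow> bool"
  where "riemannian_complete M \<longleftrightarrow>
    (\<forall>s. range s \<subseteq> M \<and>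
         (\<forall>e>0. \<exists>N. \<forall>m\<ge>N. \<forall>n\<ge>N. riemannian_dist M (s m) (s n) < e) \<longrightarrow>
         (\<exists>l\<in>M. (\<lambda>n. riemannian_dist M (s n) l) \<longlonglongrightarrow> 0))"

definition orth_projection :: "'a::euclidean_space set \<Rightarrow> 'a \<Rightarrow> 'a"
  where "orth_projection T w = (THE p. p \<in> T \<and> (\<forall>u\<in>T. orthogonal (w - p) u))"

text \<open>The argument \<open>f'\<close> is the Euclidean gradient field of the function.\<close>

definition riemannian_grad :: "'a::euclidean_space set \<Rightarrow> ('a \<Rightarrow> 'a) \<Rightarrow> 'a \<Rightarrow> 'a"
  where "riemannian_grad M f' x = orth_projection (tangent_space M x) (f' x)"

text \<open>The differential of \<open>Retr x\<close> at \<open>0\<close> is taken along the linear subspace \<open>tangent_space M x\<close>; the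
  values of \<open>Retr\<close> outside the tangent bundle are irrelevant.\<close>

definition retraction_on_manifold :: "'a::euclidean_space set \<Rightarrow> ('a \<Rightarrow> 'a \<Rightarrow> 'a) \<Rightarrow> bool"
  where "retraction_on_manifold M Retr \<longleftrightarrow>
    smooth_on_subset (tangent_bundle M) (\<lambda>(x, v). Retr x v) \<and>
    (\<forall>(x, v)\<in>tangent_bundle M. Retr x v \<in> M) \<and>
    (\<forall>x\<in>M. Retr x 0 = x \<and> (Retr x has_derivative (\<lambda>v. v)) (at 0 within tangent_space M x))"

subsection \<open>Convexity and Bregman distances\<close>

definition strongly_convex :: "real \<Rightarrow> ('a::real_inner \<Rightarrow> real) \<Rightarrow> bool"
  where "strongly_convex m h \<longleftrightarrow>
    (\<forall>x y. \<forall>u\<ge>0. \<forall>w\<ge>0. u + w = 1 \<longrightarrow>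
       h (u *\<^sub>R x + w *\<^sub>R y) \<le> u * h x + w * h y - m / 2 * u * w * (norm (x - y))\<^sup>2)"

definition subdifferential :: "('a::real_inner \<Rightarrow> real) \<Rightarrow> 'a \<Rightarrow> 'a set"
  where "subdifferential g x = {s. \<forall>y. g x + s \<bullet> (y - x) \<le> g y}"

definition bregman_dist :: "('a::real_inner \<Rightarrow> real) \<Rightarrow> ('a \<Rightarrow> 'a) \<Rightarrow> 'a \<Rightarrow> 'a \<Rightarrow> real"
  where "bregman_dist h h' y x = h y - h x - h' x \<bullet> (y - x)"

definition relatively_smooth ::
    "real \<Rightarrow> ('a::real_inner \<Rightarrow> real) \<Rightarrow> ('a \<Rightarrow> 'a) \<Rightarrow> ('a \<Rightarrow> real) \<Rightarrow> ('a \<Rightarrow> 'a) \<Rightarrow> bool"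
  where "relatively_smooth L h h' f f' \<longleftrightarrow>
    (\<forall>x y. f y \<le> f x + f' x \<bullet> (y - x) + L * bregman_dist h h' y x)"

text \<open>\<open>C1_with_gradient f f'\<close>: \<open>f\<close> is continuously differentiable and \<open>f'\<close> is its gradient field.\<close>

definition C1_with_gradient :: "('a::real_inner \<Rightarrow> real) \<Rightarrow> ('a \<Rightarrow> 'a) \<Rightarrow> bool"
  where "C1_with_gradient f f' \<longleftrightarrow> (\<forall>x. GDERIV f x :> f' x) \<and> continuous_on UNIV f'"

subsection \<open>The retraction-based Riemannian Bregman gradient method\<close>

definition bregman_direction ::
    "'a::euclidean_space set \<Rightarrow> ('a \<Rightarrow> 'a) \<Rightarrow> ('a \<Rightarrow> real) \<Rightarrow> ('a \<Rightarrow> real) \<Rightarrow> ('a \<Rightarrow> 'a) \<Rightarrow> real \<Rightarrow> 'a \<Rightarrow> 'a"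
  where "bregman_direction M f' g h h' \<gamma> x =
    arg_min_on (\<lambda>v. f' x \<bullet> v + \<gamma> * bregman_dist h h' (x + v) x + g (x + v)) (tangent_space M x)"

text \<open>The backtracking loop. Were the loop not to terminate, the result would be an unspecified
  number; termination is not presupposed by this definition.\<close>

definition backtracking_step ::
    "('a::euclidean_space \<Rightarrow> 'a \<Rightarrow> 'a) \<Rightarrow> ('a \<Rightarrow> real) \<Rightarrow> real \<Rightarrow> real \<Rightarrow> real \<Rightarrow> 'a \<Rightarrow> 'a \<Rightarrow> real"
  where "backtracking_step Retr F lam \<rho> \<gamma> x v =
    while (\<lambda>\<alpha>. F (Retr x (\<alpha> *\<^sub>R v)) - F x > - (\<gamma> * lam * \<alpha> / 4) * (norm v)\<^sup>2) (\<lambda>\<alpha>. \<rho> * \<alpha>) 1"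

end

theory Submission
  imports Defs
begin

text \<open>The model minimized in each iteration is \<open>L lam\<close>-strongly convex, so moving by \<open>\<alpha> v\<close> in the
  ambient space lowers \<open>F\<close> by at least \<open>\<alpha> L lam \<bar>v\<bar>\<^sup>2 / 2\<close>. On the compact sublevel set the retraction
  differs from \<open>x + \<alpha> v\<close> by \<open>O(\<alpha>\<^sup>2 \<bar>v\<bar>\<^sup>2)\<close> and \<open>F\<close> is Lipschitz, so every sufficiently small step passes
  the test and the accepted steps are bounded below. The decrease of \<open>F\<close> then makes \<open>\<Sum> \<bar>v\<^sub>t\<bar>\<^sup>2\<close>
  finite, which gives the complexity bound and \<open>v\<^sub>t \<rightarrow> 0\<close>. At a limit point \<open>z\<close>, every tangent vector
  is a limit of tangent vectors at the iterates, so \<open>0\<close> minimizes the model at \<open>z\<close>; a separating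
  hyperplane turns this into a subgradient.\<close>

subsection \<open>Smooth maps and tangent spaces\<close>

text \<open>Openness makes the derivative at a point depend only on values in \<open>S\<close>, so
  the induction passes through derivatives that agree merely on \<open>S\<close>.\<close>

lemma k_smooth_on_cong:
  assumes "open S" "\<And>x. x \<in> S \<Longrightarrow> f x = g x" "k_smooth_on k S f"
  shows "k_smooth_on k S g"
  using assms(2,3)
proof (induction k arbitrary: f g)
  case 0
  then show ?case
    by (metis (no_types, lifting) continuous_on_cong k_smooth_on.simps(1))
next
  case (Suc k)
  have der: "(g has_derivative frechet_derivative f (at x)) (at x)" if "x \<in> S" for x
  proof -
    have "(f has_derivative frechet_derivative f (at x)) (at x)"
      using Suc.prems(2) that frechet_derivative_works by auto
    then show ?thesis
      using has_derivative_transform_within_open[OF _ assms(1) that] Suc.prems(1) by blast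
  qed
  have eq: "frechet_derivative f (at x) = frechet_derivative g (at x)" if "x \<in> S" for x
    using frechet_derivative_at[OF der[OF that]] .
  have "k_smooth_on k S (\<lambda>x. frechet_derivative g (at x) v)" for v
    by (rule Suc.IH[of "\<lambda>x. frechet_derivative f (at x) v"]) (use eq Suc.prems(2) in auto)
  then show ?case
    using der by (auto simp: differentiable_def)
qed

text \<open>The derivative of the restriction to a line is itself the restriction of
  \<open>\<lambda>q. frechet_derivative f (at q) (s *\<^sub>R e)\<close>, so the induction closes
  without a product rule.\<close>

lemma k_smooth_on_line:
  fixes f :: "'a::real_normed_vector \<Rightarrow> 'b::real_normed_vector"
  assumes "open S" "open T" "k_smooth_on k S f" "\<And>t::real. t \<in> T \<Longrightarrow> p + t *\<^sub>R e \<in> S"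
  shows "k_smooth_on k T (\<lambda>t. f (p + t *\<^sub>R e))"
  using assms(3)
proof (induction k arbitrary: f)
  case 0
  then have "continuous_on S f" by simp
  then show ?case
    by (auto intro!: continuous_on_compose2[of S f] continuous_intros assms(4))
next
  case (Suc k)
  have der: "((\<lambda>t. f (p + t *\<^sub>R e)) has_derivative (\<lambda>s. frechet_derivative f (at (p + t *\<^sub>R e)) (s *\<^sub>R e))) (at t)"
    if "t \<in> T" for t
  proof -
    have "(f has_derivative frechet_derivative f (at (p + t *\<^sub>R e))) (at (p + t *\<^sub>R e))"
      using Suc.prems that assms(4) frechet_derivative_works by auto
    moreover have "((\<lambda>t. p + t *\<^sub>R e) has_derivative (\<lambda>s. s *\<^sub>R e)) (at t)"
      by (auto intro!: derivative_eq_intros)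
    ultimately show ?thesis
      using has_derivative_compose by fastforce
  qed
  have "k_smooth_on k T (\<lambda>t. frechet_derivative (\<lambda>t. f (p + t *\<^sub>R e)) (at t) s)" for s
  proof (rule k_smooth_on_cong[OF assms(2)])
    show "k_smooth_on k T (\<lambda>t. frechet_derivative f (at (p + t *\<^sub>R e)) (s *\<^sub>R e))"
      by (rule Suc.IH[of "\<lambda>q. frechet_derivative f (at q) (s *\<^sub>R e)"]) (use Suc.prems in auto)
  qed (use frechet_derivative_at[OF der] in metis)
  then show ?case
    using der by (auto simp: differentiable_def)
qed

lemma smooth_on_has_derivative:
  assumes "smooth_on S f" "x \<in> S"
  shows "(f has_derivative frechet_derivative f (at x)) (at x)"
proof -
  have "k_smooth_on (Suc 0) S f" using assms(1) unfolding smooth_on_def by blast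
  then show ?thesis using assms(2) frechet_derivative_works by auto
qed

lemma smooth_on_frechet_derivative:
  assumes "smooth_on S f"
  shows "smooth_on S (\<lambda>x. frechet_derivative f (at x) v)"
  unfolding smooth_on_def
proof
  fix k
  have "k_smooth_on (Suc k) S f" using assms unfolding smooth_on_def by blast
  then show "k_smooth_on k S (\<lambda>x. frechet_derivative f (at x) v)" by simp
qed

lemma smooth_on_imp_continuous_on:
  assumes "smooth_on S f"
  shows "continuous_on S f"
proof -
  have "k_smooth_on 0 S f" using assms unfolding smooth_on_def by blast
  then show ?thesis by simp
qed

text \<open>A stand-in for the operator norm that is visibly continuous in a parameter as soon as
  each \<open>A b\<close> is.\<close>

lemma linear_norm_le_sum_Basis:
  fixes A :: "'a::euclidean_space \<Rightarrow> 'b::real_normed_vector"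
  assumes "linear A"
  shows "norm (A u) \<le> (\<Sum>b\<in>Basis. norm (A b)) * norm u"
proof -
  have "A u = A (\<Sum>b\<in>Basis. (u \<bullet> b) *\<^sub>R b)"
    by (simp add: euclidean_representation)
  also have "\<dots> = (\<Sum>b\<in>Basis. (u \<bullet> b) *\<^sub>R A b)"
    by (simp add: linear_sum[OF assms] linear_cmul[OF assms])
  also have "norm \<dots> \<le> (\<Sum>b\<in>Basis. norm u * norm (A b))"
    by (rule sum_norm_le) (simp add: Basis_le_norm mult_right_mono)
  finally show ?thesis by (simp add: sum_distrib_left mult.commute)
qed

lemma C1_lipschitz_on_compact_convex:
  fixes f :: "'a::euclidean_space \<Rightarrow> 'b::real_normed_vector"
  assumes "compact S" "convex S"
    and der: "\<And>x. x \<in> S \<Longrightarrow> (f has_derivative D x) (at x)"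
    and cont: "\<And>u. continuous_on S (\<lambda>x. D x u)"
  shows "\<exists>C\<ge>0. \<forall>x\<in>S. \<forall>y\<in>S. norm (f x - f y) \<le> C * norm (x - y)"
proof -
  have "continuous_on S (\<lambda>x. \<Sum>b\<in>Basis. norm (D x b))"
    by (intro continuous_intros cont)
  then have "bounded ((\<lambda>x. \<Sum>b\<in>Basis. norm (D x b)) ` S)"
    using assms(1) compact_continuous_image compact_imp_bounded by blast
  then obtain C where C: "C > 0" "\<And>x. x \<in> S \<Longrightarrow> (\<Sum>b\<in>Basis. norm (D x b)) \<le> C"
    unfolding bounded_pos by (metis abs_le_D1 image_eqI real_norm_def)
  have "onorm (D x) \<le> C" if "x \<in> S" for x
  proof (rule onorm_le)
    fix u
    have "norm (D x u) \<le> (\<Sum>b\<in>Basis. norm (D x b)) * norm u"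
      using linear_norm_le_sum_Basis has_derivative_linear[OF der[OF that]] by blast
    also have "\<dots> \<le> C * norm u"
      using C(2)[OF that] by (simp add: mult_right_mono)
    finally show "norm (D x u) \<le> C * norm u" .
  qed
  then have "norm (f x - f y) \<le> C * norm (x - y)" if "x \<in> S" "y \<in> S" for x y
    using differentiable_bound[OF assms(2), of f D C x y] der that has_derivative_at_withinI
    by blast
  then show ?thesis using C(1) by (metis less_eq_real_def)
qed

lemma smooth_on_lipschitz_on_cball:
  fixes f :: "'a::euclidean_space \<Rightarrow> 'b::real_normed_vector"
  assumes "smooth_on S f" "cball x e \<subseteq> S"
  shows "\<exists>C\<ge>0. \<forall>y\<in>cball x e. \<forall>z\<in>cball x e. norm (f y - f z) \<le> C * norm (y - z)"
proof (rule C1_lipschitz_on_compact_convex)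
  show "(f has_derivative frechet_derivative f (at y)) (at y)" if "y \<in> cball x e" for y
    using smooth_on_has_derivative assms that by blast
  show "continuous_on (cball x e) (\<lambda>y. frechet_derivative f (at y) u)" for u
    using smooth_on_imp_continuous_on[OF smooth_on_frechet_derivative[OF assms(1)]]
      assms(2) continuous_on_subset by blast
qed auto

text \<open>\<open>P x\<close> is the differential of the inverse chart at the image of
  \<open>x\<close>, and \<open>E\<close> is the linear model of the slice. Having one
  \<open>E\<close> for all \<open>x\<close> near \<open>z\<close> makes tangent spaces at different
  points comparable.\<close>

lemma submanifold_chart:
  fixes M :: "'a::euclidean_space set"
  assumes "embedded_submanifold M" "z \<in> M"
  obtains U and E :: "'a set" and P where "open U" "z \<in> U" "subspace E"
    "\<And>x. x \<in> M \<inter> U \<Longrightarrow> tangent_space M x = P x ` E"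
    "\<And>x. x \<in> M \<inter> U \<Longrightarrow> linear (P x)"
    "\<And>e. continuous_on U (\<lambda>x. P x e)"
proof -
  obtain U V :: "'a set" and E \<phi> \<psi> where ch: "open U" "z \<in> U" "open V" "subspace E"
    "homeomorphism U V \<phi> \<psi>" "smooth_on U \<phi>" "smooth_on V \<psi>" "\<phi> ` (M \<inter> U) = E \<inter> V"
    using assms unfolding embedded_submanifold_def by metis
  note hom = ch(5)[unfolded homeomorphism_def]
  define P where "P x = frechet_derivative \<psi> (at (\<phi> x))" for x
  have \<phi>V: "\<phi> x \<in> V" if "x \<in> U" for x using that hom by blast
  have derP: "(\<psi> has_derivative P x) (at (\<phi> x))" if "x \<in> U" for x
    unfolding P_def using smooth_on_has_derivative[OF ch(7)] \<phi>V that by blast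
  have \<psi>M: "\<psi> q \<in> M" if "q \<in> E \<inter> V" for q
    using that ch(8) hom by (metis (no_types, lifting) IntD1 IntD2 imageE)
  have tan: "tangent_space M x = P x ` E" if x: "x \<in> M \<inter> U" for x
  proof (intro equalityI subsetI)
    fix v assume "v \<in> tangent_space M x"
    then obtain c r where c: "r > 0" "smooth_on {-r<..<r} c" "c ` {-r<..<r} \<subseteq> M" "c (0::real) = x"
      "(c has_vector_derivative v) (at 0)" unfolding tangent_space_def by blast
    have cder: "(c has_derivative (\<lambda>s. s *\<^sub>R v)) (at 0)"
      using c(5) by (simp add: has_vector_derivative_def)
    have d\<phi>: "(\<phi> has_derivative frechet_derivative \<phi> (at x)) (at (c 0))"
      using smooth_on_has_derivative[OF ch(6)] x c(4) by auto
    define e where "e = frechet_derivative \<phi> (at x) v"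
    have lin: "linear (frechet_derivative \<phi> (at x))"
      using d\<phi> has_derivative_linear by blast
    have d\<phi>c: "((\<lambda>t. \<phi> (c t)) has_derivative (\<lambda>s. s *\<^sub>R e)) (at 0)"
      using has_derivative_compose[OF cder d\<phi>] by (simp add: e_def linear_cmul[OF lin])
    have "isCont c 0" using cder has_derivative_continuous by blast
    then have evU: "eventually (\<lambda>t. c t \<in> U) (at 0)"
      using ch(1) x c(4) by (metis Int_iff continuous_within topological_tendstoD)
    have evr: "eventually (\<lambda>t::real. t \<in> {-r<..<r}) (at 0)"
      using c(1) by (intro eventually_at_in_open') auto
    \<comment> \<open>Near 0 the difference quotients of \<open>\<phi> (c t)\<close> lie in
      \<open>E\<close>, which is closed; hence their limit \<open>e\<close> lies in
      \<open>E\<close>.\<close>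
    have lim: "((\<lambda>t. (\<phi> (c t) - \<phi> x) /\<^sub>R t) \<longlongrightarrow> e) (at 0)"
    proof -
      have *: "((\<lambda>t. norm (\<phi> (c t) - \<phi> x - t *\<^sub>R e) / norm t) \<longlongrightarrow> 0) (at 0)"
        using d\<phi>c c(4) unfolding has_derivative_iff_norm by simp
      have "((\<lambda>t. norm ((\<phi> (c t) - \<phi> x) /\<^sub>R t - e)) \<longlongrightarrow> 0) (at 0)"
      proof (rule Lim_transform_eventually[OF *])
        have "norm (\<phi> (c t) - \<phi> x - t *\<^sub>R e) / norm t = norm ((\<phi> (c t) - \<phi> x) /\<^sub>R t - e)"
          if "t \<noteq> 0" for t
        proof -
          have "(\<phi> (c t) - \<phi> x) /\<^sub>R t - e = (\<phi> (c t) - \<phi> x - t *\<^sub>R e) /\<^sub>R t"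
            using that by (simp add: scaleR_right_diff_distrib)
          then show ?thesis by (simp add: divide_inverse_commute)
        qed
        then show "\<forall>\<^sub>F t in at 0. norm (\<phi> (c t) - \<phi> x - t *\<^sub>R e) / norm t = norm ((\<phi> (c t) - \<phi> x) /\<^sub>R t - e)"
          by (auto simp: eventually_at_filter)
      qed
      then show ?thesis by (rule LIM_zero_cancel[OF tendsto_norm_zero_cancel])
    qed
    have evE: "eventually (\<lambda>t. (\<phi> (c t) - \<phi> x) /\<^sub>R t \<in> E) (at 0)"
      using evU evr
    proof eventually_elim
      case (elim t)
      then have "c t \<in> M \<inter> U" using c(3) by blast
      then have "\<phi> (c t) \<in> E" "\<phi> x \<in> E" using ch(8) x by blast+
      then show ?case by (simp add: ch(4) subspace_diff subspace_scale)
    qed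
    have "e \<in> E"
      using Lim_in_closed_set[OF closed_subspace[OF ch(4)] evE _ lim] by simp
    \<comment> \<open>Applying \<open>\<psi>\<close> recovers \<open>c\<close> near 0, so uniqueness
      of derivatives identifies \<open>P x e\<close> with \<open>v\<close>.\<close>
    have "((\<lambda>t. \<psi> (\<phi> (c t))) has_derivative (\<lambda>s. P x (s *\<^sub>R e))) (at 0)"
      using has_derivative_compose[OF d\<phi>c, of \<psi> "P x"] derP[of x] x c(4) by auto
    moreover have "eventually (\<lambda>t. \<psi> (\<phi> (c t)) = c t) (at 0)"
      using evU by eventually_elim (use hom in auto)
    moreover have "\<psi> (\<phi> (c 0)) = c 0" using hom x c(4) by auto
    ultimately have "(c has_derivative (\<lambda>s. P x (s *\<^sub>R e))) (at 0)"
      using has_derivative_transform_eventually[of _ _ 0 UNIV] by simp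
    then have "(\<lambda>s. P x (s *\<^sub>R e)) = (\<lambda>s. s *\<^sub>R v)"
      using cder has_derivative_unique by blast
    then have "P x e = v" by (metis scaleR_one)
    with \<open>e \<in> E\<close> show "v \<in> P x ` E" by blast
  next
    fix v assume "v \<in> P x ` E"
    then obtain e where e: "e \<in> E" "v = P x e" by blast
    \<comment> \<open>The witness curve is the straight line through \<open>\<phi> x\<close> with
      direction \<open>e\<close>, carried back to \<open>M\<close> by \<open>\<psi>\<close>.\<close>
    define c where "c t = \<psi> (\<phi> x + t *\<^sub>R e)" for t
    have "open ((\<lambda>t. \<phi> x + t *\<^sub>R e) -` V)"
      by (intro open_vimage ch(3) continuous_intros)
    moreover have "0 \<in> (\<lambda>t. \<phi> x + t *\<^sub>R e) -` V" using \<phi>V x by auto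
    ultimately obtain r where r: "r > 0" "ball 0 r \<subseteq> (\<lambda>t. \<phi> x + t *\<^sub>R e) -` V"
      using open_contains_ball by blast
    have inV: "\<phi> x + t *\<^sub>R e \<in> V" if "t \<in> {-r<..<r}" for t
    proof -
      have "t \<in> ball 0 r" using that by (simp add: abs_less_iff)
      then show ?thesis using r(2) by blast
    qed
    have inE: "\<phi> x + t *\<^sub>R e \<in> E" for t
      using ch(4,8) e(1) x by (intro subspace_add subspace_scale) auto
    have "smooth_on {-r<..<r} c"
      unfolding smooth_on_def c_def
    proof
      show "k_smooth_on k {-r<..<r} (\<lambda>t. \<psi> (\<phi> x + t *\<^sub>R e))" for k
        by (rule k_smooth_on_line[OF ch(3)]) (use ch(7) inV in \<open>auto simp: smooth_on_def\<close>)
    qed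
    moreover have "c ` {-r<..<r} \<subseteq> M"
      using inV inE \<psi>M by (auto simp: c_def)
    moreover have "c 0 = x" using hom x by (simp add: c_def)
    moreover have "(c has_vector_derivative v) (at 0)"
    proof -
      have "((\<lambda>t. \<phi> x + t *\<^sub>R e) has_derivative (\<lambda>s. s *\<^sub>R e)) (at 0)"
        by (auto intro!: derivative_eq_intros)
      from has_derivative_compose[OF this, of \<psi> "P x"] derP[of x] x
      have "(c has_derivative (\<lambda>s. P x (s *\<^sub>R e))) (at 0)" unfolding c_def by auto
      moreover have "linear (P x)" using derP x has_derivative_linear by blast
      ultimately show ?thesis
        by (simp add: has_vector_derivative_def e(2) linear_cmul)
    qed
    ultimately show "v \<in> tangent_space M x"
      unfolding tangent_space_def using r(1) by blast
  qed
  have lin: "linear (P x)" if "x \<in> M \<inter> U" for x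
    using derP that has_derivative_linear by blast
  have cont: "continuous_on U (\<lambda>x. P x e)" for e
    unfolding P_def
    using smooth_on_imp_continuous_on[OF smooth_on_frechet_derivative[OF ch(7), of e]]
      smooth_on_imp_continuous_on[OF ch(6)]
    by (rule continuous_on_compose2) (use \<phi>V in auto)
  show ?thesis by (rule that[OF ch(1,2,4) tan lin cont])
qed

lemma subspace_tangent_space:
  assumes "embedded_submanifold M" "x \<in> M"
  shows "subspace (tangent_space M x)"
  using submanifold_chart[OF assms] assms(2) by (metis IntI linear_subspace_image)

text \<open>Keep the chart coordinates \<open>e\<close> of \<open>w\<close> fixed and move only the
  base point: \<open>P (y k) e\<close> is tangent at \<open>y k\<close> once \<open>y k\<close> has
  entered the chart domain.\<close>

lemma tangent_space_lower_semicontinuous: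
  fixes M :: "'a::euclidean_space set"
  assumes "embedded_submanifold M" "z \<in> M" "w \<in> tangent_space M z"
    and "\<And>k. y k \<in> M" "y \<longlonglongrightarrow> z"
  obtains u where "u \<longlonglongrightarrow> w" "eventually (\<lambda>k. u k \<in> tangent_space M (y k)) sequentially"
proof -
  obtain U and E :: "'a set" and P where ch: "open U" "z \<in> U"
    "\<And>x. x \<in> M \<inter> U \<Longrightarrow> tangent_space M x = P x ` E"
    "\<And>e. continuous_on U (\<lambda>x. P x e)"
    using submanifold_chart[OF assms(1,2)] by metis
  obtain e where e: "e \<in> E" "w = P z e" using assms(2,3) ch(2,3) by blast
  have ev: "eventually (\<lambda>k. y k \<in> U) sequentially"
    using assms(5) ch(1,2) topological_tendstoD by blast
  show ?thesis
  proof
    show "(\<lambda>k. P (y k) e) \<longlonglongrightarrow> w"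
    proof -
      have "isCont (\<lambda>x. P x e) z"
        using ch(1,2) ch(4)[of e] by (simp add: continuous_on_eq_continuous_at)
      then show ?thesis using assms(5) e(2) isCont_tendsto_compose by blast
    qed
    show "eventually (\<lambda>k. P (y k) e \<in> tangent_space M (y k)) sequentially"
      using ev by eventually_elim (use ch(3) assms(4) e(1) in blast)
  qed
qed

subsection \<open>Retractions\<close>

text \<open>The second derivative of a local smooth extension of \<open>Retr\<close> is bounded near \<open>(z, 0)\<close>, and the first
  one is the identity along the tangent space.\<close>

lemma retraction_second_order_local:
  fixes M :: "'a::euclidean_space set"
  assumes "embedded_submanifold M" "retraction_on_manifold M Retr" "z \<in> M"
  obtains C r where "C \<ge> 0" "r > 0"
    "\<And>x w. \<lbrakk>x \<in> M; norm (x - z) < r; norm w < r; w \<in> tangent_space M x\<rbrakk>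
       \<Longrightarrow> norm (Retr x w - (x + w)) \<le> C * (norm w)\<^sup>2"
proof -
  have "(z, 0) \<in> tangent_bundle M"
    unfolding tangent_bundle_def
    using assms(3) subspace_0[OF subspace_tangent_space[OF assms(1,3)]] by simp
  then obtain U R where U: "open U" "(z, 0) \<in> U" "smooth_on U R"
    and ext: "\<And>p. p \<in> tangent_bundle M \<inter> U \<Longrightarrow> R p = (\<lambda>(x, v). Retr x v) p"
    using assms(2) unfolding retraction_on_manifold_def smooth_on_subset_def by meson
  then obtain e where e: "e > 0" "cball (z, 0) e \<subseteq> U"
    using open_contains_cball by metis
  define D where "D b p = frechet_derivative R (at p) (0, b)" for b p
  have "\<exists>C\<ge>0. \<forall>p\<in>cball (z, 0) e. \<forall>q\<in>cball (z, 0) e. norm (D b p - D b q) \<le> C * norm (p - q)" for b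
    unfolding D_def
    by (rule smooth_on_lipschitz_on_cball[OF smooth_on_frechet_derivative[OF U(3)] e(2)])
  then obtain K where K: "\<And>b. K b \<ge> 0"
    "\<And>b p q. \<lbrakk>p \<in> cball (z, 0) e; q \<in> cball (z, 0) e\<rbrakk> \<Longrightarrow> norm (D b p - D b q) \<le> K b * norm (p - q)"
    by metis
  define C where "C = (\<Sum>b\<in>Basis. K b)"
  \<comment> \<open>Allowing \<open>e / 2\<close> to each component keeps the whole segment from
    \<open>(x, 0)\<close> to \<open>(x, w)\<close> in the ball of radius \<open>e\<close>.\<close>
  have "norm (Retr x w - (x + w)) \<le> C * (norm w)\<^sup>2"
    if x: "x \<in> M" "norm (x - z) < e / 2" and w: "norm w < e / 2" "w \<in> tangent_space M x" for x w
  proof -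
    note sub = subspace_tangent_space[OF assms(1) x(1)]
    have inb: "(x, t *\<^sub>R w) \<in> cball (z, 0) e" if "t \<in> {0..1}" for t
    proof -
      have "norm (t *\<^sub>R w) \<le> norm w" using that by (simp add: mult_left_le_one_le)
      moreover have "norm ((x, t *\<^sub>R w) - (z, 0)) \<le> norm (x - z) + norm (t *\<^sub>R w)"
        using norm_Pair_le[of "x - z" "t *\<^sub>R w"] by simp
      ultimately have "norm ((x, t *\<^sub>R w) - (z, 0)) \<le> e" using x w by linarith
      then show ?thesis by (metis mem_cball dist_commute dist_norm)
    qed
    have eqR: "R (x, t *\<^sub>R w) = Retr x (t *\<^sub>R w)" if "t \<in> {0..1}" for t
    proof -
      have "t *\<^sub>R w \<in> tangent_space M x" using sub w(2) by (simp add: subspace_scale)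
      then have "(x, t *\<^sub>R w) \<in> tangent_bundle M \<inter> U"
        using inb[OF that] e(2) x(1) by (auto simp: tangent_bundle_def)
      from ext[OF this] show ?thesis by simp
    qed
    have derR: "((\<lambda>t. R (x, t *\<^sub>R w)) has_derivative (\<lambda>s. s *\<^sub>R D w (x, t *\<^sub>R w))) (at t within {0..1})"
      if "t \<in> {0..1}" for t
    proof -
      have "(x, t *\<^sub>R w) \<in> U" using inb[OF that] e(2) by blast
      from smooth_on_has_derivative[OF U(3) this]
      have d: "(R has_derivative frechet_derivative R (at (x, t *\<^sub>R w))) (at (x, t *\<^sub>R w))" .
      have "((\<lambda>t. (x, t *\<^sub>R w)) has_derivative (\<lambda>s. (0, s *\<^sub>R w))) (at t within {0..1})"
        by (auto intro!: derivative_eq_intros)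
      from has_derivative_compose[OF this d]
      have "((\<lambda>t. R (x, t *\<^sub>R w)) has_derivative (\<lambda>s. frechet_derivative R (at (x, t *\<^sub>R w)) (0, s *\<^sub>R w)))
        (at t within {0..1})" .
      moreover have "frechet_derivative R (at (x, t *\<^sub>R w)) (0, s *\<^sub>R w) = s *\<^sub>R D w (x, t *\<^sub>R w)" for s
        using linear_cmul[OF has_derivative_linear[OF d], of s "(0, w)"] by (simp add: D_def)
      ultimately show ?thesis by simp
    qed
    \<comment> \<open>The curve \<open>t *\<^sub>R w\<close> is differentiated at 0 in two ways,
      through \<open>Retr x\<close> along the tangent space and through the extension
      \<open>R\<close>. Both are one-sided derivatives on the unit interval, where they are
      unique.\<close>
    have D0: "D w (x, 0) = w"
    proof -
      have "(Retr x has_derivative (\<lambda>v. v)) (at 0 within tangent_space M x)"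
        using assms(2) x(1) unfolding retraction_on_manifold_def by blast
      moreover have "(\<lambda>t. t *\<^sub>R w) ` {0..1} \<subseteq> tangent_space M x"
        using sub w(2) by (auto simp: subspace_scale)
      ultimately have "(Retr x has_derivative (\<lambda>v. v)) (at 0 within (\<lambda>t. t *\<^sub>R w) ` {0..1::real})"
        by (rule has_derivative_subset)
      then have dR: "(Retr x has_derivative (\<lambda>v. v)) (at (0 *\<^sub>R w) within (\<lambda>t. t *\<^sub>R w) ` {0..1::real})"
        by simp
      have "((\<lambda>t. t *\<^sub>R w) has_derivative (\<lambda>s. s *\<^sub>R w)) (at 0 within {0..1::real})"
        by (auto intro!: derivative_eq_intros)
      from has_derivative_in_compose[OF this dR]
      have "((\<lambda>t. Retr x (t *\<^sub>R w)) has_derivative (\<lambda>s. s *\<^sub>R w)) (at 0 within {0..1::real})" .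
      then have "((\<lambda>t. R (x, t *\<^sub>R w)) has_derivative (\<lambda>s. s *\<^sub>R w)) (at 0 within {0..1::real})"
        by (rule has_derivative_transform[rotated 2]) (use eqR in auto)
      then have "((\<lambda>t. R (x, t *\<^sub>R w)) has_vector_derivative w) (at 0 within {0..1::real})"
        by (simp add: has_vector_derivative_def)
      moreover have "((\<lambda>t. R (x, t *\<^sub>R w)) has_vector_derivative D w (x, 0)) (at 0 within {0..1::real})"
        using derR[of 0] by (simp add: has_vector_derivative_def)
      ultimately show ?thesis
        using vector_derivative_unique_within_closed_interval[of 0 1 0] by fastforce
    qed
    \<comment> \<open>The change of the fibre derivative is linear in the direction, so Lipschitz
      bounds at the basis vectors suffice. One factor \<open>norm w\<close> comes from the distance
      to \<open>(x, 0)\<close>, the other from the direction.\<close>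
    have bd: "norm (D w (x, t *\<^sub>R w) - w) \<le> C * (norm w)\<^sup>2" if t: "t \<in> {0..1}" for t
    proof -
      let ?A = "\<lambda>u. frechet_derivative R (at (x, t *\<^sub>R w)) (0, u) - frechet_derivative R (at (x, 0)) (0, u)"
      have l: "linear (frechet_derivative R (at p))" if "p \<in> cball (z, 0) e" for p
        using smooth_on_has_derivative[OF U(3)] that e(2) has_derivative_linear by blast
      have l1: "linear (frechet_derivative R (at (x, t *\<^sub>R w)))" using l inb[OF t] by blast
      have l2: "linear (frechet_derivative R (at (x, 0)))" using l inb[of 0] by simp
      have l0: "linear (\<lambda>u::'a. (0::'a, u))" by (auto intro!: linearI)
      have linA: "linear ?A"
        using linear_compose_sub[OF linear_compose[OF l0 l1] linear_compose[OF l0 l2]] by (simp add: o_def)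
      have "norm (?A w) \<le> (\<Sum>b\<in>Basis. norm (?A b)) * norm w"
        by (rule linear_norm_le_sum_Basis[OF linA])
      also have "\<dots> \<le> (\<Sum>b\<in>Basis. K b * norm w) * norm w"
      proof (intro mult_right_mono sum_mono)
        fix b :: 'a
        have "norm (?A b) \<le> K b * norm ((x, t *\<^sub>R w) - (x, 0))"
          using K(2)[OF inb[OF t] , of "(x, 0)" b] inb[of 0] by (simp add: D_def)
        also have "\<dots> \<le> K b * norm w"
          using t K(1)[of b] by (intro mult_left_mono) (auto simp: mult_left_le_one_le)
        finally show "norm (?A b) \<le> K b * norm w" .
      qed simp
      also have "\<dots> = C * (norm w)\<^sup>2"
        by (simp add: C_def sum_distrib_right power2_eq_square mult.assoc)
      finally show ?thesis using D0 by (simp add: D_def)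
    qed
    \<comment> \<open>Mean value inequality for \<open>R (x, t *\<^sub>R w) - t *\<^sub>R w\<close>,
      whose derivative was just bounded and whose value at 0 is \<open>x\<close>.\<close>
    have "norm ((R (x, 1 *\<^sub>R w) - 1 *\<^sub>R w) - (R (x, 0 *\<^sub>R w) - 0 *\<^sub>R w)) \<le> C * (norm w)\<^sup>2 * norm (1 - 0 :: real)"
    proof (rule differentiable_bound[of "{0..1::real}" "\<lambda>t. R (x, t *\<^sub>R w) - t *\<^sub>R w" "\<lambda>t s. s *\<^sub>R (D w (x, t *\<^sub>R w) - w)"])
      fix t :: real assume t: "t \<in> {0..1}"
      show "((\<lambda>t. R (x, t *\<^sub>R w) - t *\<^sub>R w) has_derivative (\<lambda>s. s *\<^sub>R (D w (x, t *\<^sub>R w) - w))) (at t within {0..1})"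
        using derR[OF t] by (auto intro!: derivative_eq_intros simp: scaleR_diff_right)
      show "onorm (\<lambda>s. s *\<^sub>R (D w (x, t *\<^sub>R w) - w)) \<le> C * (norm w)\<^sup>2"
      proof (rule onorm_le)
        fix s :: real
        have "\<bar>s\<bar> * norm (D w (x, t *\<^sub>R w) - w) \<le> \<bar>s\<bar> * (C * (norm w)\<^sup>2)"
          using bd[OF t] by (intro mult_left_mono) auto
        then show "norm (s *\<^sub>R (D w (x, t *\<^sub>R w) - w)) \<le> C * (norm w)\<^sup>2 * norm s"
          by (simp add: mult.commute)
      qed
    qed auto
    moreover have "Retr x 0 = x"
      using assms(2) x(1) unfolding retraction_on_manifold_def by blast
    ultimately show ?thesis
      using eqR[of 0] eqR[of 1] by (simp add: algebra_simps)
  qed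
  then show ?thesis
    using that[of C "e / 2"] e(1) K(1) by (simp add: C_def sum_nonneg)
qed

text \<open>A finite subcover of \<open>K\<close> by the local balls; the sum of the finitely many
  constants dominates each of them.\<close>

lemma retraction_second_order:
  fixes M :: "'a::euclidean_space set"
  assumes "embedded_submanifold M" "retraction_on_manifold M Retr" "compact K" "K \<subseteq> M"
  obtains C r where "C \<ge> 0" "r > 0"
    "\<And>x w. \<lbrakk>x \<in> K; norm w < r; w \<in> tangent_space M x\<rbrakk>
       \<Longrightarrow> norm (Retr x w - (x + w)) \<le> C * (norm w)\<^sup>2"
proof -
  have "\<forall>z\<in>K. \<exists>C r. C \<ge> 0 \<and> r > 0 \<and> (\<forall>x w. x \<in> M \<longrightarrow> norm (x - z) < r \<longrightarrow> norm w < r \<longrightarrow>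
      w \<in> tangent_space M x \<longrightarrow> norm (Retr x w - (x + w)) \<le> C * (norm w)\<^sup>2)"
    using retraction_second_order_local[OF assms(1,2)] assms(4) by (metis subsetD)
  then obtain C r where Cr: "\<And>z. z \<in> K \<Longrightarrow> C z \<ge> 0 \<and> r z > 0"
    "\<And>z x w. \<lbrakk>z \<in> K; x \<in> M; norm (x - z) < r z; norm w < r z; w \<in> tangent_space M x\<rbrakk>
       \<Longrightarrow> norm (Retr x w - (x + w)) \<le> C z * (norm w)\<^sup>2"
    by metis
  have "K \<subseteq> (\<Union>z\<in>K. ball z (r z))" using Cr(1) by force
  then obtain T where T: "T \<subseteq> K" "finite T" "K \<subseteq> (\<Union>z\<in>T. ball z (r z))"
    using compactE_image[OF assms(3), of K "\<lambda>z. ball z (r z)"] by auto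
  show ?thesis
  proof
    show "(\<Sum>z\<in>T. C z) \<ge> 0" using Cr(1) T(1) by (meson subsetD sum_nonneg)
    \<comment> \<open>The inserted 1 keeps \<open>Min\<close> meaningful when the cover is
      empty.\<close>
    show "Min (insert 1 (r ` T)) > 0" using Cr(1) T(1,2) by auto
    fix x w assume x: "x \<in> K" "norm w < Min (insert 1 (r ` T))" "w \<in> tangent_space M x"
    obtain z where z: "z \<in> T" "x \<in> ball z (r z)" using T(3) x(1) by blast
    have "norm (Retr x w - (x + w)) \<le> C z * (norm w)\<^sup>2"
      using Cr(2)[of z x w] z x T(1,2) assms(4) by (auto simp: dist_norm norm_minus_commute)
    also have "\<dots> \<le> (\<Sum>z\<in>T. C z) * (norm w)\<^sup>2"
      using member_le_sum[OF z(1), of C] Cr(1) T(1,2) by (intro mult_right_mono) auto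
    finally show "norm (Retr x w - (x + w)) \<le> (\<Sum>z\<in>T. C z) * (norm w)\<^sup>2" .
  qed
qed

subsection \<open>Convex analysis\<close>

text \<open>The definite description is legitimate because the difference of two candidates is
  orthogonal to itself.\<close>

lemma orth_projection_props:
  fixes T :: "'a::euclidean_space set"
  assumes "subspace T"
  shows "orth_projection T w \<in> T" "u \<in> T \<Longrightarrow> orthogonal (w - orth_projection T w) u"
proof -
  obtain p q where pq: "p \<in> span T" "\<And>u. u \<in> span T \<Longrightarrow> orthogonal q u" "w = p + q"
    using orthogonal_subspace_decomp_exists by metis
  have T: "span T = T" using assms span_eq_iff by blast
  have "orth_projection T w \<in> T \<and> (\<forall>u\<in>T. orthogonal (w - orth_projection T w) u)"
    unfolding orth_projection_def
  proof (rule theI)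
    show "p \<in> T \<and> (\<forall>u\<in>T. orthogonal (w - p) u)" using pq T by simp
    fix p' assume p': "p' \<in> T \<and> (\<forall>u\<in>T. orthogonal (w - p') u)"
    then have d: "p' - p \<in> T" using pq(1) T assms subspace_diff by metis
    have "(w - p) \<bullet> (p' - p) = 0" "(w - p') \<bullet> (p' - p) = 0"
      using d p' pq T by (auto simp: orthogonal_def)
    then have "(p' - p) \<bullet> (p' - p) = 0" by (simp add: inner_diff_left)
    then show "p' = p" by simp
  qed
  then show "orth_projection T w \<in> T" "u \<in> T \<Longrightarrow> orthogonal (w - orth_projection T w) u"
    by auto
qed

text \<open>The sum \<open>?p\<close> of the projections lies in \<open>T\<close>, and its inner
  product with itself equals that of \<open>a + s\<close> with \<open>?p\<close>, which
  vanishes.\<close>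

lemma orth_projection_add_eq_0:
  fixes T :: "'a::euclidean_space set"
  assumes "subspace T" "\<And>u. u \<in> T \<Longrightarrow> (a + s) \<bullet> u = 0"
  shows "orth_projection T a + orth_projection T s = 0"
proof -
  let ?p = "orth_projection T a + orth_projection T s"
  have p: "?p \<in> T" using assms(1) by (simp add: orth_projection_props subspace_add)
  have "(a - orth_projection T a) \<bullet> ?p = 0" "(s - orth_projection T s) \<bullet> ?p = 0"
    using orth_projection_props(2)[OF assms(1) p] by (auto simp: orthogonal_def)
  then have "?p \<bullet> ?p = (a + s) \<bullet> ?p" by (simp add: inner_diff_left inner_add_left)
  then have "?p \<bullet> ?p = 0" using assms(2)[OF p] by simp
  then show ?thesis by simp
qed

text \<open>The strict epigraph of \<open>g\<close> and the graph of \<open>u \<mapsto> g z + l \<bullet> u\<close> over \<open>T\<close> are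
  disjoint convex sets; a hyperplane separating them is not vertical, hence yields the subgradient.\<close>

lemma subgradient_extending_linear_minorant:
  fixes g :: "'a::euclidean_space \<Rightarrow> real"
  assumes "convex_on UNIV g" "subspace T" "\<And>u. u \<in> T \<Longrightarrow> g z + l \<bullet> u \<le> g (z + u)"
  obtains s where "s \<in> subdifferential g z" "\<And>u. u \<in> T \<Longrightarrow> s \<bullet> u = l \<bullet> u"
proof -
  define A where "A = {(y, r). g y < r}"
  define B where "B = (\<lambda>u. (z + u, g z + l \<bullet> u)) ` T"
  have "convex A"
    unfolding convex_alt
  proof (clarsimp simp: A_def)
    fix y1 r1 y2 r2 and t :: real
    assume *: "g y1 < r1" "g y2 < r2" "0 \<le> t" "t \<le> 1"
    have "g ((1 - t) *\<^sub>R y1 + t *\<^sub>R y2) \<le> (1 - t) * g y1 + t * g y2"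
      using convex_onD[OF assms(1) *(3,4), of y1 y2] by simp
    also have "\<dots> < (1 - t) * r1 + t * r2"
    proof (cases "t = 0")
      case False
      then have "t * g y2 < t * r2" using * by simp
      moreover have "(1 - t) * g y1 \<le> (1 - t) * r1" using * by (simp add: mult_left_mono)
      ultimately show ?thesis by linarith
    qed (use * in simp)
    finally show "g ((1 - t) *\<^sub>R y1 + t *\<^sub>R y2) < (1 - t) * r1 + t * r2" .
  qed
  have "convex B"
  proof -
    have "B = (+) (z, g z) ` ((\<lambda>u. (u, l \<bullet> u)) ` T)"
      by (auto simp: B_def image_image)
    moreover have "linear (\<lambda>u. (u, l \<bullet> u))"
      by (auto intro!: linearI simp: inner_add_right)
    ultimately show ?thesis
      using assms(2) by (simp add: convex_linear_image convex_translation subspace_imp_convex)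
  qed
  have "A \<inter> B = {}" using assms(3) by (fastforce simp: A_def B_def)
  moreover have "(z, g z + 1) \<in> A" by (simp add: A_def)
  moreover have "(z, g z) \<in> B"
    unfolding B_def using subspace_0[OF assms(2)] by (intro image_eqI[of _ _ 0]) auto
  ultimately obtain c \<beta> where c: "c \<noteq> 0" "\<forall>p\<in>A. c \<bullet> p \<le> \<beta>" "\<forall>p\<in>B. \<beta> \<le> c \<bullet> p"
    using separating_hyperplane_sets[OF \<open>convex A\<close> \<open>convex B\<close>] by blast
  obtain a b where ab: "c = (a, b)" by (cases c)
  have up: "a \<bullet> y + b * r \<le> \<beta>" if "g y < r" for y r
    using c(2) that ab by (auto simp: A_def)
  have low: "\<beta> \<le> a \<bullet> (z + u) + b * (g z + l \<bullet> u)" if "u \<in> T" for u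
    using c(3) that ab by (auto simp: B_def)
  have z0: "\<beta> \<le> a \<bullet> z + b * g z" using low[of 0] subspace_0[OF assms(2)] by simp
  \<comment> \<open>Letting \<open>r\<close> decrease to \<open>g y\<close> passes from the strict
    epigraph to the graph.\<close>
  have up': "a \<bullet> y + b * g y \<le> \<beta>" for y
  proof (rule tendsto_upperbound)
    show "((\<lambda>r. a \<bullet> y + b * r) \<longlongrightarrow> a \<bullet> y + b * g y) (at_right (g y))"
      by (intro tendsto_intros)
    show "\<forall>\<^sub>F r in at_right (g y). a \<bullet> y + b * r \<le> \<beta>"
      using up by (auto simp: eventually_at_filter)
  qed simp
  have beta: "\<beta> = a \<bullet> z + b * g z" using z0 up'[of z] by simp
  \<comment> \<open>The epigraph is unbounded upwards, which fixes the sign of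
    \<open>b\<close>.\<close>
  have "b \<le> 0"
    using up[of z "g z + 1"] beta by (simp add: algebra_simps)
  \<comment> \<open>A vertical hyperplane would have all of the space on one side, since
    \<open>g\<close> is finite everywhere; testing at \<open>z + a\<close> forces
    \<open>a = 0\<close>.\<close>
  moreover have "b \<noteq> 0"
  proof
    assume "b = 0"
    then have "a \<bullet> a \<le> 0" using up'[of "z + a"] beta by (simp add: inner_add_right)
    then have "a = 0" by (metis inner_gt_zero_iff not_less)
    with \<open>b = 0\<close> c(1) ab show False by (simp add: zero_prod_def)
  qed
  ultimately have b: "b < 0" by simp
  \<comment> \<open>Solving the hyperplane equation for the last coordinate gives an affine function
    with slope \<open>s\<close>.\<close>
  define s where "s = (- 1 / b) *\<^sub>R a"
  have sb: "b * (s \<bullet> y) = - (a \<bullet> y)" for y using b by (simp add: s_def)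
  show ?thesis
  proof
    have "g z + s \<bullet> (y - z) \<le> g y" for y
    proof -
      have "b * (g z + s \<bullet> (y - z)) = b * g z - a \<bullet> (y - z)" by (simp add: distrib_left sb)
      then have "b * g y \<le> b * (g z + s \<bullet> (y - z))"
        using up'[of y] beta by (simp add: inner_diff_right)
      then show ?thesis using b by simp
    qed
    then show "s \<in> subdifferential g z" by (simp add: subdifferential_def)
    fix u assume u: "u \<in> T"
    have le: "l \<bullet> u \<le> s \<bullet> u" if "u \<in> T" for u
    proof -
      have "b * (l \<bullet> u) \<ge> b * (s \<bullet> u)"
        using low[OF that] beta by (simp add: sb inner_add_right distrib_left)
      then show ?thesis using b by simp
    qed
    \<comment> \<open>The reverse inequality comes from the opposite direction, available in a
      subspace.\<close>
    have "- u \<in> T" using u assms(2) by (rule subspace_neg[rotated])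
    from le[OF u] le[OF this] show "s \<bullet> u = l \<bullet> u" by simp
  qed
qed

section \<open>First-order behaviour along rays\<close>

lemma GDERIV_directional:
  assumes "GDERIV h x :> G"
  shows "((\<lambda>t. (h (x + t *\<^sub>R w) - h x) / t) \<longlongrightarrow> G \<bullet> w) (at_right (0::real))"
proof -
  have "(h has_derivative (\<lambda>w. w \<bullet> G)) (at (x + 0 *\<^sub>R w))" using assms by (simp add: gderiv_def inner_commute)
  moreover have "((\<lambda>t::real. x + t *\<^sub>R w) has_derivative (\<lambda>s. s *\<^sub>R w)) (at 0)"
    by (auto intro!: derivative_eq_intros)
  ultimately have "((\<lambda>t. h (x + t *\<^sub>R w)) has_derivative (\<lambda>s. (s *\<^sub>R w) \<bullet> G)) (at 0)"
    using has_derivative_compose by fastforce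
  then have "((\<lambda>t. h (x + t *\<^sub>R w)) has_field_derivative (G \<bullet> w)) (at 0)"
    by (simp add: has_field_derivative_def inner_commute mult.commute[of _ "G \<bullet> w"] mult_commute_abs)
  then have "((\<lambda>t. (h (x + t *\<^sub>R w) - h x) / t) \<longlongrightarrow> G \<bullet> w) (at 0)"
    by (simp add: has_field_derivative_iff)
  then show ?thesis by (rule filterlim_mono) (simp_all add: at_le)
qed

text \<open>The Bregman distance is a first-order Taylor remainder, so it disappears from
  first-order conditions.\<close>

lemma bregman_dist_tendsto_0:
  assumes "GDERIV h x :> h' x"
  shows "((\<lambda>t. bregman_dist h h' (x + t *\<^sub>R w) x / t) \<longlongrightarrow> 0) (at_right (0::real))"
proof -
  have "((\<lambda>t. (h (x + t *\<^sub>R w) - h x) / t - h' x \<bullet> w) \<longlongrightarrow> h' x \<bullet> w - h' x \<bullet> w) (at_right 0)"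
    by (intro tendsto_intros GDERIV_directional assms)
  then have *: "((\<lambda>t. (h (x + t *\<^sub>R w) - h x) / t - h' x \<bullet> w) \<longlongrightarrow> 0) (at_right 0)"
    by simp
  show ?thesis
    by (rule Lim_transform_eventually[OF * eventually_at_rightI[of 0 1]])
       (auto simp: bregman_dist_def field_simps)
qed

text \<open>Divide the strong convexity inequality on the segment from \<open>x\<close> to
  \<open>y\<close> by \<open>t\<close> and let \<open>t\<close> tend to 0 from the right.\<close>

lemma strongly_convex_bregman_dist_ge:
  fixes h :: "'a::real_inner \<Rightarrow> real"
  assumes "strongly_convex m h" "GDERIV h x :> h' x"
  shows "m / 2 * (norm (y - x))\<^sup>2 \<le> bregman_dist h h' y x"
proof -
  have "h' x \<bullet> (y - x) \<le> h y - h x - m / 2 * (1 - 0) * (norm (y - x))\<^sup>2"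
  proof (rule tendsto_le)
    show "((\<lambda>t. (h (x + t *\<^sub>R (y - x)) - h x) / t) \<longlongrightarrow> h' x \<bullet> (y - x)) (at_right (0::real))"
      by (rule GDERIV_directional[OF assms(2)])
    show "((\<lambda>t. h y - h x - m / 2 * (1 - t) * (norm (y - x))\<^sup>2) \<longlongrightarrow>
        h y - h x - m / 2 * (1 - 0) * (norm (y - x))\<^sup>2) (at_right (0::real))"
      by (intro tendsto_intros)
    show "\<forall>\<^sub>F t in at_right 0. (h (x + t *\<^sub>R (y - x)) - h x) / t
        \<le> h y - h x - m / 2 * (1 - t) * (norm (y - x))\<^sup>2"
    proof (rule eventually_at_rightI[of 0 1])
      fix t :: real assume t: "t \<in> {0<..<1}"
      have "h (t *\<^sub>R y + (1 - t) *\<^sub>R x) \<le> t * h y + (1 - t) * h x - m / 2 * t * (1 - t) * (norm (y - x))\<^sup>2"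
        using assms(1) t unfolding strongly_convex_def by auto
      moreover have "t *\<^sub>R y + (1 - t) *\<^sub>R x = x + t *\<^sub>R (y - x)" by (simp add: algebra_simps)
      ultimately have "h (x + t *\<^sub>R (y - x)) - h x \<le> t * (h y - h x - m / 2 * (1 - t) * (norm (y - x))\<^sup>2)"
        by (simp add: algebra_simps)
      then show "(h (x + t *\<^sub>R (y - x)) - h x) / t \<le> h y - h x - m / 2 * (1 - t) * (norm (y - x))\<^sup>2"
        using t by (simp add: divide_le_eq mult.commute)
    qed simp
  qed simp
  then show ?thesis by (simp add: bregman_dist_def)
qed

lemma GDERIV_imp_continuous_on:
  assumes "\<And>x. GDERIV f x :> f' x"
  shows "continuous_on S f"
  using assms gderiv_def has_derivative_continuous continuous_at_imp_continuous_on
  by (metis GDERIV_DERIV_compose)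

subsection \<open>The algorithm\<close>

text \<open>A rejected step exceeds \<open>a\<close>, so the step tried after it is at least
  \<open>\<rho> * a\<close>; the 1 in the minimum covers acceptance of the first trial.\<close>

lemma while_backtracking:
  fixes \<rho> a :: real
  assumes "0 < \<rho>" "\<rho> < 1" "0 < a" "\<And>\<alpha>. 0 < \<alpha> \<Longrightarrow> \<alpha> \<le> a \<Longrightarrow> \<not> b \<alpha>"
  defines "s \<equiv> while b (\<lambda>\<alpha>. \<rho> * \<alpha>) 1"
  shows "\<not> b s" "min 1 (\<rho> * a) \<le> s" "s \<le> 1"
proof -
  \<comment> \<open>Generalized to any starting step for the induction: \<open>n\<close> bounds the
    number of reductions still to come.\<close>
  have main: "let s = while b (\<lambda>\<alpha>. \<rho> * \<alpha>) \<alpha> in \<not> b s \<and> min 1 (\<rho> * a) \<le> s \<and> s \<le> 1"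
    if "0 < \<alpha>" "\<alpha> \<le> 1" "min 1 (\<rho> * a) \<le> \<alpha>" "\<rho> ^ n * \<alpha> \<le> a" for n \<alpha>
    using that
  proof (induction n arbitrary: \<alpha>)
    case 0
    then have "\<not> b \<alpha>" using assms(4) by simp
    then have "while b (\<lambda>\<alpha>. \<rho> * \<alpha>) \<alpha> = \<alpha>" by (subst while_unfold) simp
    with 0 \<open>\<not> b \<alpha>\<close> show ?case by (simp add: Let_def)
  next
    case (Suc n)
    show ?case
    proof (cases "b \<alpha>")
      case True
      then have "a < \<alpha>" using assms(4) Suc.prems(1) by force
      then have "\<rho> * a \<le> \<rho> * \<alpha>" using assms(1) by simp
      then have "min 1 (\<rho> * a) \<le> \<rho> * \<alpha>" by (rule min.coboundedI2)
      moreover have "\<rho> * \<alpha> \<le> 1" using assms(1,2) Suc.prems(1,2) by (simp add: mult_le_one)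
      moreover have "\<rho> ^ n * (\<rho> * \<alpha>) \<le> a" using Suc.prems(4) by (simp add: mult_ac)
      ultimately have "let s = while b (\<lambda>\<alpha>. \<rho> * \<alpha>) (\<rho> * \<alpha>) in \<not> b s \<and> min 1 (\<rho> * a) \<le> s \<and> s \<le> 1"
        using assms(1) Suc.prems(1) by (intro Suc.IH) auto
      then show ?thesis using True by (subst while_unfold) simp
    next
      case False
      then have "while b (\<lambda>\<alpha>. \<rho> * \<alpha>) \<alpha> = \<alpha>" by (subst while_unfold) simp
      with Suc.prems False show ?thesis by (simp add: Let_def)
    qed
  qed
  obtain n where "\<rho> ^ n < a" using real_arch_pow_inv assms(2,3) by blast
  then show "\<not> b s" "min 1 (\<rho> * a) \<le> s" "s \<le> 1"
    using main[of 1 n] unfolding s_def Let_def by auto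
qed

lemma small_term_of_bounded_square_sum:
  fixes a :: "nat \<Rightarrow> real"
  assumes "\<And>n. (\<Sum>t<n. (a t)\<^sup>2) \<le> D"
  shows "\<exists>C>0. \<forall>\<epsilon>>0. \<exists>t. real t \<le> C / \<epsilon>\<^sup>2 \<and> a t \<le> \<epsilon>"
proof (intro exI[of _ "D + 1"] conjI allI impI)
  show "D + 1 > 0" using assms[of 0] by simp
  fix \<epsilon> :: real assume \<epsilon>: "\<epsilon> > 0"
  \<comment> \<open>The first \<open>N\<close> indices, counted from 0, are exactly those not above
    the claimed bound. If all their terms exceeded \<epsilon>, then
    \<open>D + 1 \<le> N * \<epsilon>\<^sup>2 \<le> D\<close>. The added 1 also keeps the constant
    positive when \<open>D\<close> is 0.\<close>
  define N where "N = Suc (nat \<lfloor>(D + 1) / \<epsilon>\<^sup>2\<rfloor>)"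
  have pos: "(D + 1) / \<epsilon>\<^sup>2 \<ge> 0" using assms[of 0] by simp
  show "\<exists>t. real t \<le> (D + 1) / \<epsilon>\<^sup>2 \<and> a t \<le> \<epsilon>"
  proof (rule ccontr)
    assume *: "\<not> ?thesis"
    have "\<epsilon>\<^sup>2 \<le> (a t)\<^sup>2" if "t < N" for t
    proof -
      have "real t \<le> (D + 1) / \<epsilon>\<^sup>2" using that pos by (simp add: N_def le_nat_iff le_floor_iff less_Suc_eq_le)
      then have "\<epsilon> \<le> a t" using * by force
      then show ?thesis using \<epsilon> by (simp add: power_mono)
    qed
    then have "real N * \<epsilon>\<^sup>2 \<le> (\<Sum>t<N. (a t)\<^sup>2)"
      using sum_bounded_below[of "{..<N}" "\<epsilon>\<^sup>2" "\<lambda>t. (a t)\<^sup>2"] by simp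
    also have "\<dots> \<le> D" by (rule assms)
    finally have "real N * \<epsilon>\<^sup>2 \<le> D" .
    moreover have "(D + 1) / \<epsilon>\<^sup>2 \<le> real N" unfolding N_def using pos by linarith
    then have "D + 1 \<le> real N * \<epsilon>\<^sup>2" using \<epsilon> by (simp add: divide_le_eq)
    ultimately show False by linarith
  qed
qed

section \<open>The Bregman model and its minimizer over a tangent space\<close>

locale riemannian_bregman =
  fixes M :: "'a::euclidean_space set" and f g h :: "'a \<Rightarrow> real" and f' h' :: "'a \<Rightarrow> 'a"
    and Lg L m :: real
  assumes submanifold: "embedded_submanifold M"
    and f_C1: "C1_with_gradient f f'"
    and g_convex: "convex_on UNIV g" "Lg-lipschitz_on UNIV g"
    and h_convex: "C1_with_gradient h h'" "strongly_convex m h" "m > 0"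
    and rel: "L > 0" "relatively_smooth L h h' f f'"
begin

text \<open>By relative smoothness \<open>f x + model x u\<close> majorizes \<open>f + g\<close> at
  \<open>x + u\<close>, with equality at \<open>u = 0\<close>.\<close>

definition model :: "'a \<Rightarrow> 'a \<Rightarrow> real"
  where "model x u = f' x \<bullet> u + L * bregman_dist h h' (x + u) x + g (x + u)"

abbreviation dir :: "'a \<Rightarrow> 'a"
  where "dir x \<equiv> bregman_direction M f' g h h' L x"

lemma dir_eq: "dir x = arg_min_on (model x) (tangent_space M x)"
  unfolding bregman_direction_def model_def ..

lemma model_0 [simp]: "model x 0 = g x"
  by (simp add: model_def bregman_dist_def)

lemma continuous_f [continuous_intros]: "continuous_on S f" "continuous_on S f'"
  and continuous_h [continuous_intros]: "continuous_on S h" "continuous_on S h'"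
  and continuous_g [continuous_intros]: "continuous_on S g"
  using f_C1 h_convex(1) g_convex(2) GDERIV_imp_continuous_on lipschitz_on_continuous_on continuous_on_subset
  unfolding C1_with_gradient_def by (metis subset_UNIV)+

lemma Lg_nonneg: "Lg \<ge> 0"
  using g_convex(2) lipschitz_on_nonneg by blast

lemma g_diff_le: "\<bar>g y - g z\<bar> \<le> Lg * norm (y - z)"
  using lipschitz_onD[OF g_convex(2), of y z] by (simp add: dist_norm)

text \<open>Coercivity: strong convexity of \<open>h\<close> supplies the quadratic term,
  Cauchy-Schwarz and the Lipschitz bound on \<open>g\<close> the linear loss.\<close>

lemma model_ge: "g x - (norm (f' x) + Lg) * norm u + L * m / 2 * (norm u)\<^sup>2 \<le> model x u"
proof -
  have "m / 2 * (norm u)\<^sup>2 \<le> bregman_dist h h' (x + u) x"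
    using strongly_convex_bregman_dist_ge[of m h x h' "x + u"] h_convex(1,2) by (simp add: C1_with_gradient_def)
  then have "L * (m / 2 * (norm u)\<^sup>2) \<le> L * bregman_dist h h' (x + u) x"
    using rel(1) by simp
  moreover have "- (norm (f' x) * norm u) \<le> f' x \<bullet> u"
    using Cauchy_Schwarz_ineq2[of "f' x" u] by (simp add: abs_le_iff)
  moreover have "g x - Lg * norm u \<le> g (x + u)"
    using g_diff_le[of "x + u" x] by (simp add: abs_le_iff)
  ultimately show ?thesis unfolding model_def by (simp add: algebra_simps)
qed

lemma model_ray:
  assumes "0 \<le> t" "t \<le> 1"
  shows "model x (t *\<^sub>R u) \<le> t * model x u + (1 - t) * g x - L * m / 2 * t * (1 - t) * (norm u)\<^sup>2"
proof -
  have eq: "t *\<^sub>R (x + u) + (1 - t) *\<^sub>R x = x + t *\<^sub>R u" by (simp add: algebra_simps)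
  have "g (x + t *\<^sub>R u) \<le> t * g (x + u) + (1 - t) * g x"
    using convex_onD[OF g_convex(1), of t x "x + u"] assms eq by (simp add: add.commute)
  moreover have "h (x + t *\<^sub>R u) \<le> t * h (x + u) + (1 - t) * h x - m / 2 * t * (1 - t) * (norm u)\<^sup>2"
    using h_convex(2)[unfolded strongly_convex_def, rule_format, of t "1 - t" "x + u" x] assms eq by simp
  then have "bregman_dist h h' (x + t *\<^sub>R u) x \<le> t * bregman_dist h h' (x + u) x - m / 2 * t * (1 - t) * (norm u)\<^sup>2"
    by (simp add: bregman_dist_def algebra_simps)
  then have "L * bregman_dist h h' (x + t *\<^sub>R u) x
      \<le> L * (t * bregman_dist h h' (x + u) x - m / 2 * t * (1 - t) * (norm u)\<^sup>2)"
    using rel(1) by simp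
  ultimately show ?thesis unfolding model_def by (simp add: algebra_simps)
qed

text \<open>\<open>arg_min_on\<close> is a choice operator, so a minimizer must be exhibited first:
  compactness gives one on a ball, and outside the ball coercivity keeps the model above its value
  at 0.\<close>

lemma dir_minimizes:
  assumes "x \<in> M"
  shows "dir x \<in> tangent_space M x" "u \<in> tangent_space M x \<Longrightarrow> model x (dir x) \<le> model x u"
proof -
  let ?T = "tangent_space M x"
  have sub: "subspace ?T" using subspace_tangent_space submanifold assms by blast
  \<comment> \<open>The radius at which the quadratic term of \<open>model_ge\<close> balances the
    linear one.\<close>
  define B where "B = 2 * (norm (f' x) + Lg) / (L * m)"
  have B0: "B \<ge> 0" using Lg_nonneg rel h_convex(3) by (simp add: B_def)
  have "compact (?T \<inter> cball 0 B)"
    by (intro closed_Int_compact closed_subspace sub compact_cball)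
  moreover have 0: "0 \<in> ?T \<inter> cball 0 B" using subspace_0[OF sub] B0 by simp
  moreover have "continuous_on (?T \<inter> cball 0 B) (model x)"
    unfolding model_def bregman_dist_def
    by (intro continuous_intros continuous_on_compose2[OF continuous_h(1)[of UNIV]]
        continuous_on_compose2[OF continuous_g[of UNIV]]) auto
  ultimately obtain w where w: "w \<in> ?T \<inter> cball 0 B" "\<And>u. u \<in> ?T \<inter> cball 0 B \<Longrightarrow> model x w \<le> model x u"
    using continuous_attains_inf by (metis empty_iff)
  have min: "model x w \<le> model x u" if "u \<in> ?T" for u
  proof (cases "norm u \<le> B")
    case False
    then have "2 * (norm (f' x) + Lg) < L * m * norm u"
      using rel h_convex(3) by (simp add: B_def divide_less_eq mult.commute not_le)
    then have "2 * (norm (f' x) + Lg) * norm u \<le> (L * m * norm u) * norm u"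
      by (intro mult_right_mono) auto
    then have "(norm (f' x) + Lg) * norm u \<le> L * m / 2 * (norm u)\<^sup>2"
      by (simp add: power2_eq_square algebra_simps)
    then have "g x \<le> model x u" using model_ge[of x u] by linarith
    moreover have "model x w \<le> g x" using w(2)[OF 0] by simp
    ultimately show ?thesis by linarith
  qed (use w(2) that in auto)
  have "is_arg_min (model x) (\<lambda>u. u \<in> ?T) w"
    using w(1) min by (auto simp: is_arg_min_linorder)
  then have "is_arg_min (model x) (\<lambda>u. u \<in> ?T) (dir x)"
    unfolding dir_eq arg_min_on_def arg_min_def by (rule someI)
  then show "dir x \<in> ?T" "u \<in> ?T \<Longrightarrow> model x (dir x) \<le> model x u"
    by (auto simp: is_arg_min_linorder)
qed

text \<open>Compare the minimizer \<open>?v\<close> with \<open>t *\<^sub>R ?v\<close>, divide by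
  \<open>1 - t\<close> and let \<open>t\<close> tend to 1 from the left.\<close>

lemma model_dir_le:
  assumes "x \<in> M"
  shows "model x (dir x) \<le> g x - L * m / 2 * (norm (dir x))\<^sup>2"
proof -
  let ?v = "dir x"
  have "model x ?v \<le> g x - L * m / 2 * 1 * (norm ?v)\<^sup>2"
  proof (rule tendsto_le)
    show "((\<lambda>t. g x - L * m / 2 * t * (norm ?v)\<^sup>2) \<longlongrightarrow> g x - L * m / 2 * 1 * (norm ?v)\<^sup>2) (at_left (1::real))"
      by (intro tendsto_intros)
    show "((\<lambda>t. model x ?v) \<longlongrightarrow> model x ?v) (at_left (1::real))" by simp
    show "\<forall>\<^sub>F t in at_left 1. model x ?v \<le> g x - L * m / 2 * t * (norm ?v)\<^sup>2"
    proof (rule eventually_at_leftI[of 0])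
      fix t :: real assume t: "t \<in> {0<..<1}"
      have "t *\<^sub>R ?v \<in> tangent_space M x"
        using dir_minimizes(1)[OF assms] subspace_tangent_space[OF submanifold assms] by (simp add: subspace_scale)
      then have "model x ?v \<le> model x (t *\<^sub>R ?v)" by (rule dir_minimizes(2)[OF assms])
      also have "\<dots> \<le> t * model x ?v + (1 - t) * g x - L * m / 2 * t * (1 - t) * (norm ?v)\<^sup>2"
        using model_ray t by simp
      finally have "(1 - t) * model x ?v \<le> (1 - t) * (g x - L * m / 2 * t * (norm ?v)\<^sup>2)"
        by (simp add: algebra_simps)
      then show "model x ?v \<le> g x - L * m / 2 * t * (norm ?v)\<^sup>2" using t by simp
    qed simp
  qed simp
  then show ?thesis by simp
qed

text \<open>The bounds of \<open>model_ge\<close> and \<open>model_dir_le\<close> meet at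
  \<open>dir x\<close>; cancelling one factor \<open>norm (dir x)\<close> bounds the directions
  uniformly wherever \<open>f'\<close> is bounded.\<close>

lemma norm_dir_le:
  assumes "x \<in> M"
  shows "norm (dir x) \<le> (norm (f' x) + Lg) / (L * m)"
proof (cases "dir x = 0")
  case True
  then show ?thesis using Lg_nonneg rel h_convex(3) by simp
next
  case False
  have "L * m * norm (dir x) * norm (dir x) \<le> (norm (f' x) + Lg) * norm (dir x)"
    using model_ge[of x "dir x"] model_dir_le[OF assms] by (simp add: power2_eq_square)
  then have "L * m * norm (dir x) \<le> norm (f' x) + Lg" using False by simp
  then show ?thesis using rel h_convex(3) by (simp add: le_divide_eq mult.commute)
qed

text \<open>Majorization followed by convexity of the model along the ray. The decrease is twice
  what the line search asks for; the surplus will absorb the retraction error.\<close>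

lemma objective_decrease_tangent:
  assumes "x \<in> M" "0 \<le> t" "t \<le> 1"
  shows "f (x + t *\<^sub>R dir x) + g (x + t *\<^sub>R dir x) \<le> f x + g x - t * (L * m / 2) * (norm (dir x))\<^sup>2"
proof -
  let ?v = "dir x"
  have "f (x + t *\<^sub>R ?v) + g (x + t *\<^sub>R ?v) \<le> f x + model x (t *\<^sub>R ?v)"
    using rel(2)[unfolded relatively_smooth_def, rule_format, of "x + t *\<^sub>R ?v" x] by (simp add: model_def)
  also have "model x (t *\<^sub>R ?v) \<le> t * model x ?v + (1 - t) * g x"
    using model_ray[OF assms(2,3), of x ?v] assms(2,3) rel(1) h_convex(3)
    by (smt (verit) mult_nonneg_nonneg zero_le_power2 divide_nonneg_nonneg)
  also have "t * model x ?v \<le> t * (g x - L * m / 2 * (norm ?v)\<^sup>2)"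
    using model_dir_le[OF assms(1)] assms(2) by (rule mult_left_mono)
  finally show ?thesis by (simp add: algebra_simps)
qed

section \<open>Step sizes accepted uniformly on a compact set\<close>

lemma objective_lipschitz_on_cball:
  obtains C where "C \<ge> 0"
    "\<And>y z. \<lbrakk>y \<in> cball 0 B; z \<in> cball 0 B\<rbrakk> \<Longrightarrow> f y + g y - (f z + g z) \<le> C * norm (y - z)"
proof -
  have "\<exists>C\<ge>0. \<forall>y\<in>cball 0 B. \<forall>z\<in>cball 0 B. norm (f y - f z) \<le> C * norm (y - z)"
  proof (rule C1_lipschitz_on_compact_convex)
    show "(f has_derivative (\<lambda>u. u \<bullet> f' y)) (at y)" for y
      using f_C1 by (simp add: C1_with_gradient_def gderiv_def inner_commute)
  qed (auto intro!: continuous_intros)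
  then obtain C where C: "C \<ge> 0" "\<And>y z. \<lbrakk>y \<in> cball 0 B; z \<in> cball 0 B\<rbrakk> \<Longrightarrow> norm (f y - f z) \<le> C * norm (y - z)"
    by blast
  show ?thesis
  proof
    show "C + Lg \<ge> 0" using C(1) Lg_nonneg by simp
    fix y z :: 'a assume "y \<in> cball 0 B" "z \<in> cball 0 B"
    from C(2)[OF this] g_diff_le[of y z] show "f y + g y - (f z + g z) \<le> (C + Lg) * norm (y - z)"
      by (simp add: distrib_right)
  qed
qed

lemma uniform_line_search:
  assumes "retraction_on_manifold M Retr" "compact K" "K \<subseteq> M"
  obtains a where "a > 0"
    "\<And>x t. \<lbrakk>x \<in> K; 0 < t; t \<le> a\<rbrakk> \<Longrightarrow>
       f (Retr x (t *\<^sub>R dir x)) + g (Retr x (t *\<^sub>R dir x)) - (f x + g x) \<le> - (L * m * t / 4) * (norm (dir x))\<^sup>2"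
proof -
  obtain C r where C: "C \<ge> 0" "r > 0"
    "\<And>x w. \<lbrakk>x \<in> K; norm w < r; w \<in> tangent_space M x\<rbrakk> \<Longrightarrow> norm (Retr x w - (x + w)) \<le> C * (norm w)\<^sup>2"
    using retraction_second_order[OF submanifold assms] by metis
  have "bounded (f' ` K)"
    by (intro compact_imp_bounded compact_continuous_image continuous_intros assms(2))
  then obtain G where G: "\<And>x. x \<in> K \<Longrightarrow> norm (f' x) \<le> G" unfolding bounded_iff by blast
  obtain b where b: "\<And>x. x \<in> K \<Longrightarrow> norm x \<le> b"
    using compact_imp_bounded[OF assms(2)] unfolding bounded_iff by blast
  \<comment> \<open>The maximum with 1 keeps \<open>R\<close> positive, as
    \<open>r / (2 * R)\<close> requires.\<close>
  define R where "R = max 1 ((G + Lg) / (L * m))"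
  have R: "norm (dir x) \<le> R" if "x \<in> K" for x
  proof -
    have "norm (dir x) \<le> (norm (f' x) + Lg) / (L * m)" using norm_dir_le that assms(3) by blast
    also have "\<dots> \<le> (G + Lg) / (L * m)" using G[OF that] rel(1) h_convex(3) by (simp add: divide_right_mono)
    finally show ?thesis by (simp add: R_def)
  qed
  have R1: "R \<ge> 1" by (simp add: R_def)
  \<comment> \<open>Large enough for both \<open>x + ?w\<close> and \<open>Retr x ?w\<close>: the
    base point, the direction and the retraction error are bounded by the three summands.\<close>
  define B where "B = b + R + C * R\<^sup>2"
  obtain LF where LF: "LF \<ge> 0"
    "\<And>y z. \<lbrakk>y \<in> cball 0 B; z \<in> cball 0 B\<rbrakk> \<Longrightarrow> f y + g y - (f z + g z) \<le> LF * norm (y - z)"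
    using objective_lipschitz_on_cball[of B] by metis
  \<comment> \<open>The three bounds ensure, in turn, that the step is at most 1, that
    \<open>?w\<close> lies within the radius \<open>r\<close>, and that \<open>LF * C * t\<close> is
    at most \<open>L * m / 4\<close>; the added 1 avoids a zero denominator.\<close>
  define a where "a = min 1 (min (r / (2 * R)) (L * m / (4 * (LF * C + 1))))"
  have LC: "LF * C \<ge> 0" using LF(1) C(1) by simp
  show ?thesis
  proof
    show "a > 0" using C(2) R1 rel(1) h_convex(3) LC by (simp add: a_def)
    fix x t assume x: "x \<in> K" and t: "0 < t" "t \<le> a"
    let ?v = "dir x"
    let ?w = "t *\<^sub>R ?v"
    have xM: "x \<in> M" using x assms(3) by blast
    have t1: "t \<le> 1" "t \<le> r / (2 * R)" "t \<le> L * m / (4 * (LF * C + 1))" using t(2) by (auto simp: a_def)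
    have "t * R < r" using t1(2) C(2) R1 by (simp add: le_divide_eq)
    moreover have "norm ?w \<le> t * R" using R[OF x] t(1) by (simp add: mult_left_mono)
    ultimately have nr: "norm ?w < r" by linarith
    have wT: "?w \<in> tangent_space M x"
      using dir_minimizes(1)[OF xM] subspace_tangent_space[OF submanifold xM] by (simp add: subspace_scale)
    note ret = C(3)[OF x nr wT]
    have "norm ?w \<le> norm ?v" using t(1) t1(1) by (simp add: mult_left_le_one_le)
    then have nR: "norm ?w \<le> R" using R[OF x] by linarith
    then have "C * (norm ?w)\<^sup>2 \<le> C * R\<^sup>2" using C(1) by (intro mult_left_mono power_mono) auto
    then have "norm (x + ?w) \<le> b + R" "norm (Retr x ?w - (x + ?w)) \<le> C * R\<^sup>2"
      using norm_triangle_ineq[of x ?w] b[OF x] nR ret by linarith+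
    moreover have "C * R\<^sup>2 \<ge> 0" using C(1) by simp
    ultimately have "x + ?w \<in> cball 0 B" "Retr x ?w \<in> cball 0 B"
      using norm_triangle_sub[of "Retr x ?w" "x + ?w"] by (auto simp: B_def)
    from LF(2)[OF this(2,1)]
    have "f (Retr x ?w) + g (Retr x ?w) - (f (x + ?w) + g (x + ?w)) \<le> LF * norm (Retr x ?w - (x + ?w))" .
    also have "\<dots> \<le> LF * (C * (norm ?w)\<^sup>2)" using ret LF(1) by (rule mult_left_mono)
    \<comment> \<open>The error is quadratic in \<open>t\<close>, so one factor \<open>t\<close> is
      left over to make it small against the linear decrease.\<close>
    also have "\<dots> = t * (LF * C * t) * (norm ?v)\<^sup>2"
      by (simp add: power2_eq_square mult_ac)
    also have "\<dots> \<le> t * (L * m / 4) * (norm ?v)\<^sup>2"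
    proof -
      have "t * (4 * (LF * C + 1)) \<le> L * m" using t1(3) LC by (simp add: le_divide_eq)
      then have "LF * C * t \<le> L * m / 4" using t(1) by (simp add: algebra_simps)
      then show ?thesis using t(1) by (intro mult_right_mono mult_left_mono) auto
    qed
    finally show "f (Retr x ?w) + g (Retr x ?w) - (f x + g x) \<le> - (L * m * t / 4) * (norm ?v)\<^sup>2"
      using objective_decrease_tangent[OF xM _ t1(1)] t(1) by (simp add: algebra_simps)
  qed
qed

section \<open>Optimality of limit points\<close>

lemma model_tendsto:
  assumes "y \<longlonglongrightarrow> z" "u \<longlonglongrightarrow> w"
  shows "(\<lambda>k. model (y k) (u k)) \<longlonglongrightarrow> model z w"
proof -
  have iso: "isCont f' p" "isCont h p" "isCont h' p" "isCont g p" for p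
    using continuous_f(2)[of UNIV] continuous_h[of UNIV] continuous_g[of UNIV]
    by (simp_all add: continuous_on_eq_continuous_at)
  show ?thesis unfolding model_def bregman_dist_def
    by (intro tendsto_intros isCont_tendsto_compose[OF iso(1)] isCont_tendsto_compose[OF iso(2)]
        isCont_tendsto_compose[OF iso(3)] isCont_tendsto_compose[OF iso(4)] assms)
qed

text \<open>Testing with \<open>t *\<^sub>R w\<close>, using convexity of \<open>g\<close> and
  dividing by \<open>t\<close> removes the Bregman term in the limit. Then \<open>- f' z\<close> is
  a linear minorant direction for \<open>g\<close> along the tangent space and extends to a
  subgradient \<open>s\<close>, so \<open>f' z + s\<close> is normal.\<close>

lemma optimal_of_model_minimizer:
  assumes "z \<in> M" "\<And>w. w \<in> tangent_space M z \<Longrightarrow> g z \<le> model z w"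
  obtains s where "s \<in> subdifferential g z"
    "riemannian_grad M f' z + orth_projection (tangent_space M z) s = 0"
proof -
  let ?T = "tangent_space M z"
  have sub: "subspace ?T" by (rule subspace_tangent_space[OF submanifold assms(1)])
  have "g z \<le> f' z \<bullet> w + L * 0 + g (z + w)" if w: "w \<in> ?T" for w
  proof (rule tendsto_lowerbound)
    show "((\<lambda>t. f' z \<bullet> w + L * (bregman_dist h h' (z + t *\<^sub>R w) z / t) + g (z + w)) \<longlongrightarrow>
        f' z \<bullet> w + L * 0 + g (z + w)) (at_right (0::real))"
      using h_convex(1) by (intro tendsto_intros bregman_dist_tendsto_0) (simp add: C1_with_gradient_def)
    show "\<forall>\<^sub>F t in at_right 0. g z \<le> f' z \<bullet> w + L * (bregman_dist h h' (z + t *\<^sub>R w) z / t) + g (z + w)"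
    proof (rule eventually_at_rightI[of 0 1])
      fix t :: real assume t: "t \<in> {0<..<1}"
      have "t *\<^sub>R w \<in> ?T" using sub w by (simp add: subspace_scale)
      from assms(2)[OF this]
      have "g z \<le> t * (f' z \<bullet> w) + L * bregman_dist h h' (z + t *\<^sub>R w) z + g (z + t *\<^sub>R w)"
        by (simp add: model_def)
      also have "z + t *\<^sub>R w = (1 - t) *\<^sub>R z + t *\<^sub>R (z + w)" by (simp add: algebra_simps)
      also have "g \<dots> \<le> (1 - t) * g z + t * g (z + w)"
        using convex_onD[OF g_convex(1), of t z "z + w"] t by simp
      finally have "t * g z \<le> t * (f' z \<bullet> w) + L * bregman_dist h h' (z + t *\<^sub>R w) z + t * g (z + w)"
        by (simp add: algebra_simps)
      also have "\<dots> = t * (f' z \<bullet> w + L * (bregman_dist h h' (z + t *\<^sub>R w) z / t) + g (z + w))"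
        using t by (simp add: algebra_simps)
      finally show "g z \<le> f' z \<bullet> w + L * (bregman_dist h h' (z + t *\<^sub>R w) z / t) + g (z + w)"
        using t by (simp add: mult_le_cancel_left)
    qed simp
  qed simp
  then have "g z + (- f' z) \<bullet> w \<le> g (z + w)" if "w \<in> ?T" for w using that by fastforce
  from subgradient_extending_linear_minorant[OF g_convex(1) sub this]
  obtain s where s: "s \<in> subdifferential g z" "\<And>u. u \<in> ?T \<Longrightarrow> s \<bullet> u = (- f' z) \<bullet> u" by metis
  show ?thesis
  proof
    show "riemannian_grad M f' z + orth_projection ?T s = 0"
      unfolding riemannian_grad_def
      by (rule orth_projection_add_eq_0[OF sub]) (simp add: inner_add_left s(2))
  qed (rule s(1))
qed

text \<open>Each tangent vector at \<open>z\<close> is approximated by tangent vectors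
  \<open>u k\<close> at \<open>y k\<close>; minimality of \<open>dir (y k)\<close> against
  \<open>u k\<close> passes to the limit by continuity of the model.\<close>

lemma limit_point_optimal:
  assumes "\<And>k. y k \<in> M" "z \<in> M" "y \<longlonglongrightarrow> z" "(\<lambda>k. dir (y k)) \<longlonglongrightarrow> 0"
  obtains s where "s \<in> subdifferential g z"
    "riemannian_grad M f' z + orth_projection (tangent_space M z) s = 0"
proof (rule optimal_of_model_minimizer[OF assms(2)])
  fix w assume "w \<in> tangent_space M z"
  then obtain u where u: "u \<longlonglongrightarrow> w" "eventually (\<lambda>k. u k \<in> tangent_space M (y k)) sequentially"
    using tangent_space_lower_semicontinuous[OF submanifold assms(2) _ assms(1,3)] by metis
  have "eventually (\<lambda>k. model (y k) (dir (y k)) \<le> model (y k) (u k)) sequentially"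
    using u(2) by eventually_elim (rule dir_minimizes(2)[OF assms(1)])
  then have "model z 0 \<le> model z w"
    using tendsto_le[OF _ model_tendsto[OF assms(3) u(1)] model_tendsto[OF assms(3,4)]] by simp
  then show "g z \<le> model z w" by simp
qed (rule that)

end

section \<open>Convergence and complexity of the method\<close>

theorem theorem3p1:
  fixes M :: "(real ^ 'n) set"
    and f g h F :: "real ^ 'n \<Rightarrow> real"
    and gradf gradh :: "real ^ 'n \<Rightarrow> real ^ 'n"
    and Retr :: "real ^ 'n \<Rightarrow> real ^ 'n \<Rightarrow> real ^ 'n"
    and Lg L lam \<rho> :: real
    and \<gamma> \<alpha> :: "nat \<Rightarrow> real"
    and xt :: "real ^ 'n"
    and x v :: "nat \<Rightarrow> real ^ 'n"
  assumes manifold: "embedded_submanifold M" "riemannian_complete M"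
    and retraction: "retraction_on_manifold M Retr"
    and f: "C1_with_gradient f gradf"
    and g: "convex_on UNIV g" "Lg-lipschitz_on UNIV g"
    and F: "F = (\<lambda>y. f y + g y)" "bdd_below (F ` M)"
    and h: "C1_with_gradient h gradh" "lam > 0" "strongly_convex lam h"
    and rel_smooth: "L > 0" "relatively_smooth L h gradh f gradf"
    and sublevel: "xt \<in> M" "compact {y \<in> M. F y \<le> F xt}"
    and params: "0 < \<rho>" "\<rho> < 1" "\<And>t. \<gamma> t = L"
    and run:
      "x 0 = xt"
      "\<And>t. v t = bregman_direction M gradf g h gradh (\<gamma> t) (x t)"
      "\<And>t. \<alpha> t = backtracking_step Retr F lam \<rho> (\<gamma> t) (x t) (v t)"
      "\<And>t. x (Suc t) = Retr (x t) (\<alpha> t *\<^sub>R v t)"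
  shows "(\<forall>z r. strict_mono r \<and> (x \<circ> r) \<longlonglongrightarrow> z \<longrightarrow>
             z \<in> M \<and>
             0 \<in> {riemannian_grad M gradf z + orth_projection (tangent_space M z) s | s.
                    s \<in> subdifferential g z})
       \<and> (\<exists>C>0. \<forall>\<epsilon>>0. \<exists>t. real t \<le> C / \<epsilon>\<^sup>2 \<and> norm (v t) \<le> \<epsilon>)"
proof -
  interpret riemannian_bregman M f g h gradf gradh Lg L lam
    by unfold_locales (fact manifold f g h rel_smooth)+
  define K where "K = {y \<in> M. F y \<le> F xt}"
  have v: "v t = dir (x t)" for t using run(2) params(3) by simp
  obtain a where a: "a > 0" "\<And>y t. \<lbrakk>y \<in> K; 0 < t; t \<le> a\<rbrakk> \<Longrightarrow>
      F (Retr y (t *\<^sub>R dir y)) - F y \<le> - (L * lam * t / 4) * (norm (dir y))\<^sup>2"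
    using uniform_line_search[OF retraction, of K] sublevel(2) unfolding K_def F(1) by auto
  \<comment> \<open>A lower bound for every accepted step at a point of \<open>K\<close>.\<close>
  define c where "c = min 1 (\<rho> * a)"
  have c: "c > 0" using a(1) params(1) by (simp add: c_def)
  \<comment> \<open>Conditional on \<open>x t \<in> K\<close>, where \<open>a\<close> is valid; the
    resulting descent then keeps all iterates in \<open>K\<close> by induction.\<close>
  have step: "x (Suc t) \<in> M \<and> F (x (Suc t)) \<le> F (x t) - L * lam * c / 4 * (norm (v t))\<^sup>2" if "x t \<in> K" for t
  proof -
    let ?b = "\<lambda>s. F (Retr (x t) (s *\<^sub>R v t)) - F (x t) > - (L * lam * s / 4) * (norm (v t))\<^sup>2"
    have \<alpha>: "\<alpha> t = while ?b (\<lambda>s. \<rho> * s) 1"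
      using run(3) params(3) by (simp add: backtracking_step_def)
    have nb: "\<not> ?b s" if "0 < s" "s \<le> a" for s
      using a(2)[OF \<open>x t \<in> K\<close> that] v by (simp add: not_less)
    note bt = while_backtracking[of \<rho> a ?b, OF params(1,2) a(1) nb, folded \<alpha>]
    have xM: "x t \<in> M" using that by (simp add: K_def)
    have "\<alpha> t *\<^sub>R v t \<in> tangent_space M (x t)"
      using dir_minimizes(1)[OF xM] subspace_tangent_space[OF manifold(1) xM] v by (simp add: subspace_scale)
    then have "x (Suc t) \<in> M"
      using retraction xM unfolding retraction_on_manifold_def tangent_bundle_def run(4) by blast
    moreover have "F (x (Suc t)) \<le> F (x t) - L * lam * \<alpha> t / 4 * (norm (v t))\<^sup>2"
      using bt(1) run(4) by simp
    moreover have "L * lam * c / 4 * (norm (v t))\<^sup>2 \<le> L * lam * \<alpha> t / 4 * (norm (v t))\<^sup>2"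
      using bt(2) rel_smooth(1) h(2) unfolding c_def
      by (intro mult_right_mono divide_right_mono mult_left_mono) auto
    ultimately show ?thesis by linarith
  qed
  have nonneg: "0 \<le> L * lam * c / 4 * (norm (v t))\<^sup>2" for t
    using rel_smooth(1) h(2) c by simp
  have xK: "x t \<in> K" for t
  proof (induction t)
    case 0
    then show ?case using sublevel(1) run(1) by (simp add: K_def)
  next
    case (Suc t)
    then show ?case using step[OF Suc] nonneg[of t] by (simp add: K_def)
  qed
  then have xM: "x t \<in> M" for t by (simp add: K_def)
  obtain lb where lb: "\<And>y. y \<in> M \<Longrightarrow> lb \<le> F y" using F(2) unfolding bdd_below_def by blast
  \<comment> \<open>The total possible decrease of \<open>F\<close> divided by the guaranteed
    decrease per unit of squared direction length.\<close>
  define D where "D = (F xt - lb) / (L * lam * c / 4)"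
  have sum_le: "(\<Sum>t<n. (norm (v t))\<^sup>2) \<le> D" for n
  proof -
    have "(L * lam * c / 4) * (\<Sum>t<n. (norm (v t))\<^sup>2) \<le> F xt - F (x n)"
    proof (induction n)
      case (Suc n)
      then show ?case using step[OF xK[of n]] by (simp add: distrib_left)
    qed (simp add: run(1))
    also have "\<dots> \<le> F xt - lb" using lb[OF xM[of n]] by simp
    finally show ?thesis
      using rel_smooth(1) h(2) c by (simp add: D_def le_divide_eq mult_ac)
  qed
  have "summable (\<lambda>t. (norm (v t))\<^sup>2)"
    by (rule summableI_nonneg_bounded[OF _ sum_le]) simp
  then have "(\<lambda>t. (norm (v t))\<^sup>2) \<longlonglongrightarrow> 0" by (rule summable_LIMSEQ_zero)
  from tendsto_real_sqrt[OF this] have v0: "v \<longlonglongrightarrow> 0"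
    by (simp add: tendsto_norm_zero_iff)
  show ?thesis
  proof (intro conjI allI impI)
    fix z r assume "strict_mono (r :: nat \<Rightarrow> nat) \<and> (x \<circ> r) \<longlonglongrightarrow> z"
    then have r: "strict_mono r" "(\<lambda>k. x (r k)) \<longlonglongrightarrow> z" by (auto simp: o_def)
    \<comment> \<open>\<open>M\<close> need not be closed in the ambient space; the limit stays in
      it because the compact sublevel set is closed.\<close>
    have "closed K" using sublevel(2) compact_imp_closed by (simp add: K_def)
    then have "z \<in> K" using closed_sequentially[of K "\<lambda>k. x (r k)" z] xK r(2) by blast
    then show zM: "z \<in> M" by (simp add: K_def)
    have "(\<lambda>k. dir (x (r k))) \<longlonglongrightarrow> 0"
      using LIMSEQ_subseq_LIMSEQ[OF v0 r(1)] v by (simp add: o_def)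
    then obtain s where "s \<in> subdifferential g z"
      "riemannian_grad M gradf z + orth_projection (tangent_space M z) s = 0"
      using limit_point_optimal[OF xM zM r(2)] by metis
    then show "0 \<in> {riemannian_grad M gradf z + orth_projection (tangent_space M z) s | s. s \<in> subdifferential g z}"
      by force
  next
    show "\<exists>C>0. \<forall>\<epsilon>>0. \<exists>t. real t \<le> C / \<epsilon>\<^sup>2 \<and> norm (v t) \<le> \<epsilon>"
      by (rule small_term_of_bounded_square_sum[OF sum_le])
  qed
qed

end
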